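(* If $$\lambda\ll\frac{d^{1/4}}{\sqrt m\,\mathrm{poly}\log(d,m)},$$ then every function $f:(y_1,\dots,y_{md})\mapsto\mathbb R$ of degree $(md)^{o(1)}$ (that is, a polynomial of that degree in the entries of $y_1,\dots,y_{md}\in\mathbb R^d$) such that $\mathbb E_{\mathrm{null}}f(y_1,\dots,y_{md})^2=1$ satisfies $$\left|\mathbb E_{\mathrm{planted}}f-\mathbb E_{\mathrm{null}}f\right|\le o(1).$$
   Context: Let $d,m\in\mathbb N$ and $0<\lambda<1$. In the single-spike block mixtures testing problem the goal is to distinguish, given vectors $y_1,\dots,y_{md}\in\mathbb R^d$, between the following two distributions; $\mathbb E_{\mathrm{null}}$ and $\mathbb E_{\mathrm{planted}}$ denote expectations under them. Null: $y_1,\dots,y_{md}\sim\mathcal N(0,\mathrm{Id})$ i.i.d. Planted: first $x\sim\{\pm1/\sqrt d\}^d$ and $s_1,\dots,s_d\sim\{\pm1\}$ are drawn uniformly at random and independently. Then, conditionally on $x$ and $s_1,\dots,s_d$, the vectors $y_j$ are independent, with $y_1,\dots,y_m\sim\mathcal N(0,\mathrm{Id}+s_1\lambda xx^\top)$, $y_{m+1},\dots,y_{2m}\sim\mathcal N(0,\mathrm{Id}+s_2\lambda xx^\top)$, and so forth: the $md$ vectors are split into $d$ consecutive blocks of $m$ vectors, and every vector in the $i$-th block has distribution $\mathcal N(0,\mathrm{Id}+s_i\lambda xx^\top)$. Asymptotic notation is as $d,m\to\infty$, and $\mathrm{poly}\log(d,m)$ denotes a factor polynomial in the logarithms of $d$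 and $m$.
   Formalization: The polylog(d,m) factor is replaced by a fixed power of (1+D)·ln(dm), D being the degree bound: with a pure polylog factor the claim fails for some superpolylogarithmic degrees, e.g. m=d, D=exp(√log d), λ=d^{-1/4}/polylog(d). For polylogarithmic D the factor is still polylogarithmic. *)

theory Defs
  imports "HOL-Probability.Probability" "HOL-Library.Landau_Symbols"
begin

text \<open>
  The dimension varies inside the statement, so a vector of \<open>\<real>\<^sup>d\<close> is a function
  \<open>nat \<Rightarrow> real\<close> restricted to \<open>{..<d}\<close>. A sample \<open>y\<close> is a family of \<open>m * d\<close> such vectors;
  all indices start at 0.
\<close>

definition std_gaussian :: "nat \<Rightarrow> (nat \<Rightarrow> real) measure" where
  "std_gaussian d = (\<Pi>\<^sub>M i\<in>{..<d}. density lborel std_normal_density)"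

text \<open>
  \<open>N(0, S)\<close> is the law of \<open>A z\<close> for a standard Gaussian \<open>z\<close> and any \<open>A\<close> with \<open>A A\<^sup>T = S\<close>;
  the law does not depend on which such \<open>A\<close> is chosen. It is meaningful only for positive
  semidefinite \<open>S\<close>.
\<close>

definition cov_factor :: "nat \<Rightarrow> (nat \<Rightarrow> nat \<Rightarrow> real) \<Rightarrow> (nat \<Rightarrow> nat \<Rightarrow> real) \<Rightarrow> bool" where
  "cov_factor d S A \<longleftrightarrow> (\<forall>i<d. \<forall>j<d. (\<Sum>k<d. A i k * A j k) = S i j)"

definition gaussian :: "nat \<Rightarrow> (nat \<Rightarrow> nat \<Rightarrow> real) \<Rightarrow> (nat \<Rightarrow> real) measure" where
  "gaussian d S =
     (let A = (SOME A. cov_factor d S A)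
      in distr (std_gaussian d) (\<Pi>\<^sub>M i\<in>{..<d}. borel) (\<lambda>z. \<lambda>i\<in>{..<d}. \<Sum>k<d. A i k * z k))"

definition spiked_cov :: "real \<Rightarrow> (nat \<Rightarrow> real) \<Rightarrow> nat \<Rightarrow> nat \<Rightarrow> real" where
  "spiked_cov t x i j = (if i = j then 1 else 0) + t * x i * x j"

lemma spiked_cov_has_factor:
  assumes "t \<ge> -1" and x: "(\<Sum>i<d. (x i)\<^sup>2) = 1"
  shows "\<exists>A. cov_factor d (spiked_cov t x) A"
proof -
  define c where "c = sqrt (1 + t) - 1"
  have c: "2 * c + c\<^sup>2 = t"
    using assms(1) by (simp add: c_def power2_eq_square algebra_simps)
  have "(\<Sum>k<d. spiked_cov c x i k * spiked_cov c x j k) = spiked_cov t x i j"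
    if i: "i < d" and j: "j < d" for i j
  proof -
    have "(\<Sum>k<d. spiked_cov c x i k * spiked_cov c x j k)
        = (\<Sum>k<d. (if k = i then (if i = j then 1 else 0) else 0)
             + (if k = i then c * x j * x k else 0) + (if k = j then c * x i * x k else 0)
             + c\<^sup>2 * x i * x j * (x k)\<^sup>2)"
      by (rule sum.cong) (auto simp: spiked_cov_def power2_eq_square algebra_simps)
    also have "\<dots> = (if i = j then 1 else 0) + c * x j * x i + c * x i * x j
        + c\<^sup>2 * x i * x j * (\<Sum>k<d. (x k)\<^sup>2)"
      using i j by (simp add: sum.distrib sum_distrib_left)
    also have "\<dots> = (if i = j then 1 else 0) + (2 * c + c\<^sup>2) * x i * x j"
      unfolding x by (simp add: algebra_simps)
    finally show ?thesis
      unfolding c by (simp add: spiked_cov_def)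
  qed
  then show ?thesis
    unfolding cov_factor_def by blast
qed

definition null_dist :: "nat \<Rightarrow> nat \<Rightarrow> (nat \<Rightarrow> nat \<Rightarrow> real) measure" where
  "null_dist d m = (\<Pi>\<^sub>M j\<in>{..<m * d}. std_gaussian d)"

definition planted_prior :: "nat \<Rightarrow> ((nat \<Rightarrow> real) \<times> (nat \<Rightarrow> real)) pmf" where
  "planted_prior d =
     pair_pmf (pmf_of_set ({..<d} \<rightarrow>\<^sub>E {1 / sqrt (real d), - 1 / sqrt (real d)}))
              (pmf_of_set ({..<d} \<rightarrow>\<^sub>E {1, -1}))"

text \<open>The vector with index \<open>j\<close> lies in the block with index \<open>j div m\<close>.\<close>

definition planted_dist :: "nat \<Rightarrow> nat \<Rightarrow> real \<Rightarrow> (nat \<Rightarrow> nat \<Rightarrow> real) measure" where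
  "planted_dist d m l =
     measure_pmf (planted_prior d) \<bind>
       (\<lambda>(x, s). \<Pi>\<^sub>M j\<in>{..<m * d}. gaussian d (spiked_cov (s (j div m) * l) x))"

definition poly_fun :: "nat \<Rightarrow> nat \<Rightarrow> nat \<Rightarrow> ((nat \<Rightarrow> nat \<Rightarrow> real) \<Rightarrow> real) \<Rightarrow> bool" where
  "poly_fun N d D f \<longleftrightarrow>
     (\<exists>(E :: (nat \<Rightarrow> nat \<Rightarrow> nat) set) (c :: (nat \<Rightarrow> nat \<Rightarrow> nat) \<Rightarrow> real).
        finite E \<and> (\<forall>e\<in>E. (\<Sum>j<N. \<Sum>i<d. e j i) \<le> D) \<and>
        (\<forall>y. f y = (\<Sum>e\<in>E. c e * (\<Prod>j<N. \<Prod>i<d. y j i ^ e j i))))"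

text \<open>
  In the next definition a bound of the form \<open>(m d)\<^bsup>o(1)\<^esup>\<close> is expressed along a sequence of
  parameters \<open>(d n, m n)\<close>.
\<close>

definition subpoly :: "(nat \<Rightarrow> nat) \<Rightarrow> (nat \<Rightarrow> nat) \<Rightarrow> (nat \<Rightarrow> nat) \<Rightarrow> bool" where
  "subpoly d m D \<longleftrightarrow>
     (\<exists>\<epsilon>. \<epsilon> \<longlonglongrightarrow> 0 \<and>
        (\<forall>\<^sub>F n in sequentially. real (D n) \<le> real (m n * d n) powr \<epsilon> n))"

text \<open>
  The factor lost below the threshold \<open>d\<^bsup>1/4\<^esup> / sqrt m\<close>: polynomial in the logarithms of \<open>d\<close> and
  \<open>m\<close> and in the degree bound \<open>D\<close>, hence polylogarithmic in \<open>d, m\<close> whenever \<open>D\<close> is. The powers of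
  \<open>D\<close> cannot be dropped. Write \<open>r = m\<^sup>2 l\<^sup>4 / d\<close>. For \<open>k\<close> much smaller than \<open>sqrt d\<close>, the
  Hermite coefficients supported on \<open>k\<close> blocks, with two vectors of degree 2 in each, contribute
  to the squared norm of the degree-\<open>4 k\<close> likelihood ratio about
  \<open>(d choose k) (m choose 2)\<^sup>k (l\<^sup>4/4)\<^sup>k E\<langle>x,x'\<rangle>\<^bsup>4k\<^esup>\<close>, with \<open>x, x'\<close> independent spikes,
  that is about \<open>(2 k r / exp 1)\<^sup>k\<close>; this diverges as soon as \<open>k r\<close> does, and it does when
  \<open>1 / r\<close> is polylogarithmic but \<open>k\<close> is superpolylogarithmic.
\<close>

definition loss_factor :: "nat \<Rightarrow> nat \<Rightarrow> nat \<Rightarrow> nat \<Rightarrow> real" where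
  "loss_factor C d m D = ((1 + real D) * ln (real (d * m))) ^ C"

end

theory Submission
  imports Defs
begin

text \<open>
  Conditionally on the prior draw \<open>(x, s)\<close>, the density of a vector \<open>N(0, Id + t x x\<^sup>T)\<close> relative
  to the standard Gaussian has the formal Hermite expansion
  \<open>\<Sum>l. (t/2)\<^sup>l / l! He\<^bsub>2l\<^esub>(\<langle>x, y\<rangle>)\<close>, and a polynomial of degree at most \<open>D\<close> in all vectors only sees
  the products \<open>\<Prod>j\<close> of its terms with \<open>2 (\<Sum>j. l j) \<le> D\<close>. So \<open>E\<^sub>p f - E\<^sub>n f\<close> is the null inner
  product of \<open>f\<close> with the prior average \<open>G\<close> of these products, the constant one omitted, and
  Cauchy-Schwarz leaves \<open>E\<^sub>n G\<^sup>2\<close> to be bounded. Since \<open>E He\<^bsub>k\<^esub>(\<langle>x, z\<rangle>) He\<^bsub>l\<^esub>(\<langle>x', z\<rangle>)\<close> is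
  \<open>k! \<langle>x, x'\<rangle>\<^sup>k\<close> if \<open>k = l\<close> and \<open>0\<close> otherwise, this is a sum over single profiles \<open>l\<close>. Averaging
  over the signs kills every profile having a block with odd sum. At most \<open>(d m\<^sup>2)\<^sup>k\<close> profiles of
  total \<open>2 k\<close> survive, each contributing at most
  \<open>\<lambda>\<^bsup>4k\<^esup> E \<langle>x, x'\<rangle>\<^bsup>4k\<^esup> \<le> 6 (4 k)! \<lambda>\<^bsup>4k\<^esup> / d\<^bsup>2k\<^esup>\<close>. As \<open>4 k \<le> D\<close>, the whole sum is dominated by a
  geometric series in \<open>D\<^sup>4 m\<^sup>2 \<lambda>\<^sup>4 / d\<close>, and a single power of the loss factor makes this ratio
  tend to \<open>0\<close>.
\<close>

section \<open>Gaussian integration by parts\<close>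

abbreviation gauss1 :: "real measure" where
  "gauss1 \<equiv> density lborel std_normal_density"

lemma prob_space_gauss1: "prob_space gauss1"
  by (rule prob_space_normal_density) simp

interpretation gauss_product: product_sigma_finite "\<lambda>_ :: nat. gauss1"
  by (simp add: product_sigma_finite_def prob_space_gauss1 prob_space_imp_sigma_finite)

definition gauss_moment :: "nat \<Rightarrow> real" where
  "gauss_moment n = (\<integral>x. x ^ n \<partial>gauss1)"

lemma integrable_gauss1_power: "integrable gauss1 (\<lambda>x. x ^ n)"
  by (subst integrable_density) (use integrable_std_normal_moment[of n] in auto)

lemma gauss_moment_eq: "gauss_moment n = (\<integral>x. std_normal_density x * x ^ n \<partial>lborel)"
  unfolding gauss_moment_def by (subst integral_density) auto

text \<open>The one-dimensional Stein identity for powers, read off the closed formula for the even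
  moments and the vanishing of the odd ones. At \<open>n = 0\<close> the truncated
  \<open>n - 1\<close> is harmless because of the factor \<open>real n\<close>.\<close>

lemma gauss_moment_Suc: "gauss_moment (Suc n) = real n * gauss_moment (n - 1)"
proof (cases "even n")
  case True
  then obtain k where k: "n = 2 * k" by blast
  have "gauss_moment (Suc n) = 0"
    using integral_std_normal_moment_odd[of k] by (simp add: gauss_moment_eq k)
  moreover have "real n * gauss_moment (n - 1) = 0"
  proof (cases k)
    case (Suc j)
    then show ?thesis
      using integral_std_normal_moment_odd[of j] by (simp add: gauss_moment_eq k)
  qed (simp add: k)
  ultimately show ?thesis by simp
next
  case False
  then obtain k where k: "n = Suc (2 * k)" by (metis oddE Suc_eq_plus1)
  have "gauss_moment (2 * Suc k) = real n * gauss_moment (2 * k)"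
  proof -
    have "fact (2 * Suc k) / (2 ^ Suc k * fact (Suc k)) =
        (2 * (1 + real k)) * ((1 + 2 * real k) * fact (2 * k)) /
            ((2 * (1 + real k)) * (2 ^ k * fact k))"
      by (simp add: algebra_simps)
    also have "\<dots> = real n * (fact (2 * k) / (2 ^ k * fact k))"
      by (subst mult_divide_mult_cancel_left) (auto simp: k)
    finally show ?thesis
      unfolding gauss_moment_eq integral_std_normal_moment_even .
  qed
  then show ?thesis by (simp add: k)
qed

section \<open>Monomials and polynomials under the standard Gaussian\<close>

definition mon :: "nat \<Rightarrow> (nat \<Rightarrow> nat) \<Rightarrow> (nat \<Rightarrow> real) \<Rightarrow> real" where
  "mon d e z = (\<Prod>i<d. z i ^ e i)"

lemma mon_0 [simp]: "mon d (\<lambda>_. 0) z = 1"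
  by (simp add: mon_def)

lemma mon_remove: "k < d \<Longrightarrow> mon d e z = z k ^ e k * (\<Prod>i\<in>{..<d} - {k}. z i ^ e i)"
  unfolding mon_def by (subst prod.remove[of _ k]) auto

lemma mon_Suc:
  assumes "k < d"
  shows "mon d (e(k := Suc (e k))) z = z k * mon d e z"
proof -
  have "(\<Prod>i\<in>{..<d} - {k}. z i ^ (e(k := Suc (e k))) i) = (\<Prod>i\<in>{..<d} - {k}. z i ^ e i)"
    by (rule prod.cong) auto
  then show ?thesis
    using assms by (simp add: mon_remove)
qed

lemma
  shows integrable_mon: "integrable (std_gaussian d) (mon d e)"
    and integral_mon: "(\<integral>z. mon d e z \<partial>std_gaussian d) = (\<Prod>i<d. gauss_moment (e i))"
proof -
  show "integrable (std_gaussian d) (mon d e)"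
    unfolding std_gaussian_def mon_def[abs_def]
    by (rule gauss_product.product_integrable_prod) (auto intro: integrable_gauss1_power)
  show "(\<integral>z. mon d e z \<partial>std_gaussian d) = (\<Prod>i<d. gauss_moment (e i))"
    unfolding std_gaussian_def mon_def[abs_def] gauss_moment_def
    by (rule gauss_product.product_integral_prod) (auto intro: integrable_gauss1_power)
qed

text \<open>Integrals of monomials factor over the coordinates, so the moment recursion acts on
  coordinate \<open>i\<close> alone.\<close>

lemma mon_stein:
  assumes i: "i < d"
  shows "(\<integral>z. z i * mon d e z \<partial>std_gaussian d) =
    real (e i) * (\<integral>z. mon d (e(i := e i - 1)) z \<partial>std_gaussian d)"
proof -
  have "(\<Prod>k\<in>{..<d}. gauss_moment ((e(i := a)) k)) =
      gauss_moment a * (\<Prod>k\<in>{..<d} - {i}. gauss_moment (e k))" for a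
  proof -
    have "(\<Prod>k\<in>{..<d} - {i}. gauss_moment ((e(i := a)) k)) =
        (\<Prod>k\<in>{..<d} - {i}. gauss_moment (e k))"
      by (rule prod.cong) auto
    then show ?thesis
      using i by (subst prod.remove[of _ i]) auto
  qed
  then show ?thesis
    by (simp only: mon_Suc[OF i, symmetric] integral_mon) (simp add: gauss_moment_Suc)
qed

text \<open>
  \<open>poly_deriv d F dF\<close>: \<open>F\<close> is a polynomial in the first \<open>d\<close> coordinates with partial derivatives \<open>dF i\<close>; the
  values of \<open>dF i\<close> for \<open>i \<ge> d\<close> are irrelevant.
\<close>

inductive poly_deriv :: "nat \<Rightarrow> ((nat \<Rightarrow> real) \<Rightarrow> real) \<Rightarrow> (nat \<Rightarrow> (nat \<Rightarrow> real) \<Rightarrow> real) \<Rightarrow> bool"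
  for d where
  const: "poly_deriv d (\<lambda>_. c) (\<lambda>_ _. 0)"
| add: "poly_deriv d F dF \<Longrightarrow> poly_deriv d G dG \<Longrightarrow>
    poly_deriv d (\<lambda>z. F z + G z) (\<lambda>i z. dF i z + dG i z)"
| var: "k < d \<Longrightarrow> poly_deriv d F dF \<Longrightarrow>
    poly_deriv d (\<lambda>z. z k * F z) (\<lambda>i z. (if i = k then F z else 0) + z k * dF i z)"
| cong: "poly_deriv d F dF \<Longrightarrow> (\<And>i z. i < d \<Longrightarrow> dF i z = dG i z) \<Longrightarrow> poly_deriv d F dG"

lemma poly_deriv_eqI:
  assumes "poly_deriv d F dF" "\<And>z. F z = G z" "\<And>i z. i < d \<Longrightarrow> dF i z = dG i z"
  shows "poly_deriv d G dG"
proof -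
  have "F = G" using assms(2) by auto
  then show ?thesis using assms(1,3) by (auto intro: poly_deriv.cong)
qed

lemma poly_deriv_scale: "poly_deriv d F dF \<Longrightarrow> poly_deriv d (\<lambda>z. c * F z) (\<lambda>i z. c * dF i z)"
proof (induction rule: poly_deriv.induct)
  case (const a)
  show ?case using poly_deriv.const[of d "c * a"] by simp
next
  case (add F dF G dG)
  show ?case by (rule poly_deriv_eqI[OF poly_deriv.add[OF add.IH]]) (auto simp: algebra_simps)
next
  case (var k F dF)
  show ?case by (rule poly_deriv_eqI[OF poly_deriv.var[OF var.hyps(1) var.IH]])
      (auto simp: algebra_simps)
next
  case (cong F dF dG)
  show ?case by (rule poly_deriv_eqI[OF cong.IH]) (auto simp: cong.hyps)
qed

lemma poly_deriv_mult:
  assumes "poly_deriv d F dF" and G: "poly_deriv d G dG"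
  shows "poly_deriv d (\<lambda>z. F z * G z) (\<lambda>i z. dF i z * G z + F z * dG i z)"
  using assms(1)
proof (induction rule: poly_deriv.induct)
  case (const a)
  show ?case by (rule poly_deriv_eqI[OF poly_deriv_scale[OF G]]) auto
next
  case (add F dF G dG)
  show ?case by (rule poly_deriv_eqI[OF poly_deriv.add[OF add.IH]]) (auto simp: algebra_simps)
next
  case (var k F dF)
  show ?case by (rule poly_deriv_eqI[OF poly_deriv.var[OF var.hyps(1) var.IH]])
      (auto simp: algebra_simps)
next
  case (cong F dF dG)
  show ?case by (rule poly_deriv_eqI[OF cong.IH]) (auto simp: cong.hyps)
qed

lemma poly_deriv_sum:
  assumes "finite K" "\<And>k. k \<in> K \<Longrightarrow> poly_deriv d (F k) (dF k)"
  shows "poly_deriv d (\<lambda>z. \<Sum>k\<in>K. F k z) (\<lambda>i z. \<Sum>k\<in>K. dF k i z)"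
  using assms
proof (induction K rule: finite_induct)
  case empty
  show ?case using poly_deriv.const[of d 0] by simp
next
  case (insert k K)
  show ?case
    by (rule poly_deriv_eqI[OF poly_deriv.add[OF insert.prems[of k] insert.IH]])
        (use insert in auto)
qed

lemma poly_deriv_coord: "k < d \<Longrightarrow> poly_deriv d (\<lambda>z. z k) (\<lambda>i z. if i = k then 1 else 0)"
  by (rule poly_deriv_eqI[OF poly_deriv.var[OF _ poly_deriv.const[of d 1]]]) auto

lemma poly_deriv_linear: "poly_deriv d (\<lambda>z. \<Sum>k<d. a k * z k) (\<lambda>i z. a i)"
  by (rule poly_deriv_eqI[OF poly_deriv_sum[where K = "{..<d}", OF _ poly_deriv_scale[OF
      poly_deriv_coord]]])
     (auto simp: if_distrib cong: if_cong)

text \<open>Induction on the total degree, splitting off a variable with positive exponent. Where an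
  exponent is 0, the factor \<open>real (e i)\<close> kills the term with the truncated
  exponent.\<close>

lemma poly_deriv_mon: "poly_deriv d (mon d e) (\<lambda>i z. real (e i) * mon d (e(i := e i - 1)) z)"
proof (induction "\<Sum>i<d. e i" arbitrary: e)
  case 0
  then have "\<And>i. i < d \<Longrightarrow> e i = 0" by auto
  then show ?case
    by (intro poly_deriv_eqI[OF poly_deriv.const[of d 1]]) (auto simp: mon_def)
next
  case (Suc n)
  then obtain k where k: "k < d" "e k > 0"
    by (metis (no_types, lifting) finite_lessThan lessThan_iff sum_eq_0_iff bot_nat_0.not_eq_extremum
        nat.distinct(1))
  define e' where "e' = e(k := e k - 1)"
  have e: "e = e'(k := Suc (e' k))" using k by (auto simp: e'_def)
  have "(\<Sum>i<d. e i) = Suc (\<Sum>i<d. e' i)"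
    using k(1) unfolding e by (simp add: sum.remove[of "{..<d}" k] )
  then have IH: "poly_deriv d (mon d e') (\<lambda>i z. real (e' i) * mon d (e'(i := e' i - 1)) z)"
    using Suc by simp
  show ?case
  proof (rule poly_deriv_eqI[OF poly_deriv.var[OF k(1) IH]])
    fix i z
    show "z k * mon d e' z = mon d e z" for z unfolding e by (simp add: mon_Suc[OF k(1)])
    assume "i < d"
    show "(if i = k then mon d e' z else 0) + z k * (real (e' i) * mon d (e'(i := e' i - 1)) z) =
      real (e i) * mon d (e(i := e i - 1)) z"
    proof (cases "i = k")
      case True
      have "z k * (real (e' k) * mon d (e'(k := e' k - 1)) z) = real (e' k) * mon d e' z"
        using mon_Suc[OF k(1), of "e'(k := e' k - 1)" z] by (cases "e' k") (auto simp: fun_upd_idem)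
      then show ?thesis using True by (simp add: e algebra_simps)
    next
      case False
      have "e(i := e i - 1) = (e'(i := e' i - 1))(k := Suc ((e'(i := e' i - 1)) k))"
        using False by (auto simp: e)
      then have "mon d (e(i := e i - 1)) z = z k * mon d (e'(i := e' i - 1)) z"
        by (simp only: mon_Suc[OF k(1)])
      then show ?thesis using False by (simp add: e)
    qed
  qed
qed

definition linear_image :: "nat \<Rightarrow> (nat \<Rightarrow> nat \<Rightarrow> real) \<Rightarrow> (nat \<Rightarrow> real) \<Rightarrow> nat \<Rightarrow> real" where
  "linear_image d A z = (\<lambda>i\<in>{..<d}. \<Sum>k<d. A i k * z k)"

text \<open>The chain rule: the gradient of \<open>F\<close> at the image is multiplied by the
  transpose of \<open>A\<close>. This is what later turns integration by parts into the covariance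
  matrix.\<close>

lemma poly_deriv_linear_image:
  assumes "poly_deriv d F dF"
  shows "poly_deriv d (\<lambda>z. F (linear_image d A z)) (\<lambda>k z. \<Sum>p<d. A p k * dF p (linear_image d A z))"
  using assms
proof (induction rule: poly_deriv.induct)
  case (const c)
  show ?case using poly_deriv.const[of d c] by simp
next
  case (add F dF G dG)
  show ?case by (rule poly_deriv_eqI[OF poly_deriv.add[OF add.IH]])
      (auto simp: algebra_simps sum.distrib)
next
  case (var k F dF)
  show ?case
    by (rule poly_deriv_eqI[OF poly_deriv_mult[OF poly_deriv_linear[of d "A k"] var.IH]])
       (use var.hyps in \<open>auto simp: linear_image_def algebra_simps sum.distrib sum_distrib_left
          if_distrib[of "\<lambda>x. _ * x"] cong: if_cong\<close>)
next
  case (cong F dF dG)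
  show ?case by (rule poly_deriv_eqI[OF cong.IH]) (auto simp: cong.hyps)
qed

text \<open>
  The monomial factor makes the induction work: a variable split off \<open>F\<close> is absorbed into it.
\<close>

lemma poly_deriv_stein_mon:
  assumes "poly_deriv d F dF"
  shows "integrable (std_gaussian d) (\<lambda>z. mon d e z * F z) \<and>
    (\<forall>i<d. integrable (std_gaussian d) (\<lambda>z. mon d e z * dF i z) \<and>
      (\<integral>z. z i * mon d e z * F z \<partial>std_gaussian d) =
      real (e i) * (\<integral>z. mon d (e(i := e i - 1)) z * F z \<partial>std_gaussian d) +
      (\<integral>z. mon d e z * dF i z \<partial>std_gaussian d))"
  using assms
proof (induction arbitrary: e rule: poly_deriv.induct)
  case (const c)
  show ?case
  proof (intro conjI allI impI, goal_cases)
    case (3 i)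
    have "(\<integral>z. z i * mon d e z * c \<partial>std_gaussian d) =
        real (e i) * (\<integral>z. mon d (e(i := e i - 1)) z \<partial>std_gaussian d) * c"
      unfolding mon_stein[OF 3, symmetric] by simp
    also have "\<dots> = real (e i) * (\<integral>z. mon d (e(i := e i - 1)) z * c \<partial>std_gaussian d)"
      by (simp only: integral_mult_left_zero mult.assoc)
    finally show ?case by (simp only: mult_zero_right integral_zero add_0_right)
  qed (auto simp: integrable_mon)
next
  case (add F dF G dG)
  have *: "z i * mon d e z = mon d (e(i := Suc (e i))) z" if "i < d" for i z
    using that by (simp add: mon_Suc)
  show ?case
  proof (intro conjI allI impI, goal_cases)
    case 1
    show ?case using add.IH by (simp add: algebra_simps)
  next
    case (2 i)
    then show ?case using add.IH by (simp add: algebra_simps)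
  next
    case (3 i)
    have int: "integrable (std_gaussian d) (\<lambda>z. mon d e z * F z)"
      "integrable (std_gaussian d) (\<lambda>z. mon d e z * G z)"
      "integrable (std_gaussian d) (\<lambda>z. mon d e z * dF i z)"
      "integrable (std_gaussian d) (\<lambda>z. mon d e z * dG i z)" for e
      using add.IH 3 by blast+
    have "(\<integral>z. z i * mon d e z * (F z + G z) \<partial>std_gaussian d) =
        (\<integral>z. z i * mon d e z * F z \<partial>std_gaussian d) + (\<integral>z. z i * mon d e z * G z \<partial>std_gaussian d)"
      unfolding *[OF 3] distrib_left by (rule Bochner_Integration.integral_add; rule int)
    also have "(\<integral>z. z i * mon d e z * F z \<partial>std_gaussian d) =
      real (e i) * (\<integral>z. mon d (e(i := e i - 1)) z * F z \<partial>std_gaussian d) +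
      (\<integral>z. mon d e z * dF i z \<partial>std_gaussian d)"
      using add.IH(1) 3 by blast
    also have "(\<integral>z. z i * mon d e z * G z \<partial>std_gaussian d) =
      real (e i) * (\<integral>z. mon d (e(i := e i - 1)) z * G z \<partial>std_gaussian d) +
      (\<integral>z. mon d e z * dG i z \<partial>std_gaussian d)"
      using add.IH(2) 3 by blast
    finally show ?case
      unfolding distrib_left by (subst (1 2) Bochner_Integration.integral_add)
        (simp_all only: int distrib_left add_ac)
  qed
next
  case (var k F dF)
  have *: "mon d e z * (z k * x) = mon d (e(k := Suc (e k))) z * x" for e x z
    using var.hyps(1) by (simp add: mon_Suc)
  show ?case
  proof (intro conjI allI impI, goal_cases)
    case 1
    show ?case using var.IH by (simp add: *)
  next
    case (2 i)
    then show ?case using var.IH by (cases "i = k") (auto simp: * distrib_left)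
  next
    case (3 i)
    have "(\<integral>z. z i * mon d e z * (z k * F z) \<partial>std_gaussian d) =
        (\<integral>z. z i * mon d (e(k := Suc (e k))) z * F z \<partial>std_gaussian d)"
      using var.hyps(1) by (intro Bochner_Integration.integral_cong) (auto simp: mon_Suc)
    also have "\<dots> = real ((e(k := Suc (e k))) i) *
          (\<integral>z. mon d ((e(k := Suc (e k)))(i := (e(k := Suc (e k))) i - 1)) z *
              F z \<partial>std_gaussian d) +
      (\<integral>z. mon d e z * (z k * dF i z) \<partial>std_gaussian d)"
      unfolding * using var.IH 3 by blast
    also have "\<dots> = real (e i) * (\<integral>z. mon d (e(i := e i - 1)) z * (z k * F z) \<partial>std_gaussian d) +
      (\<integral>z. mon d e z * (if i = k then F z else 0) \<partial>std_gaussian d) +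
      (\<integral>z. mon d e z * (z k * dF i z) \<partial>std_gaussian d)"
    proof (cases "i = k")
      case True
      have 1: "(e(k := Suc (e k)))(k := (e(k := Suc (e k))) k - 1) = e" by simp
      have 2: "(e(k := e k - 1))(k := Suc ((e(k := e k - 1)) k)) = e" if "e k > 0"
        using that by auto
      have "real (e k) * (\<integral>z. mon d (e(k := e k - 1)) z * (z k * F z) \<partial>std_gaussian d)
          = real (e k) * (\<integral>z. mon d e z * F z \<partial>std_gaussian d)"
        unfolding * using 2 by (cases "e k = 0") simp_all
      then show ?thesis unfolding True 1 by (simp only: if_True of_nat_Suc fun_upd_same)
          (simp add: distrib_right)
    next
      case False
      then have "(e(k := Suc (e k)))(i := (e(k := Suc (e k))) i - 1) =
          (e(i := e i - 1))(k := Suc ((e(i := e i - 1)) k))" by auto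
      then show ?thesis unfolding * using False by simp
    qed
    also have "\<dots> = real (e i) * (\<integral>z. mon d (e(i := e i - 1)) z * (z k * F z) \<partial>std_gaussian d) +
      (\<integral>z. mon d e z * ((if i = k then F z else 0) + z k * dF i z) \<partial>std_gaussian d)"
    proof -
      have "integrable (std_gaussian d) (\<lambda>z. mon d e z * (if i = k then F z else 0))"
        using var.IH by (cases "i = k") auto
      moreover have "integrable (std_gaussian d) (\<lambda>z. mon d e z * (z k * dF i z))"
        using var.IH 3 by (simp add: *)
      ultimately show ?thesis by (simp add: distrib_left)
    qed
    finally show ?case .
  qed
next
  case (cong F dF dG)
  have "(\<integral>z. mon d e z * dF i z \<partial>std_gaussian d) = (\<integral>z. mon d e z * dG i z \<partial>std_gaussian d)"
    "integrable (std_gaussian d) (\<lambda>z. mon d e z * dF i z) =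
        integrable (std_gaussian d) (\<lambda>z. mon d e z * dG i z)"
    if "i < d" for i
    using cong.hyps(2)[OF that] by simp_all
  then show ?case using cong.IH[of e] by auto
qed

text \<open>Stein's identity for polynomials, obtained from the stronger induction statement at the
  trivial monomial.\<close>

lemma
  assumes "poly_deriv d F dF"
  shows poly_deriv_integrable: "integrable (std_gaussian d) F"
    and poly_deriv_integrable_deriv: "i < d \<Longrightarrow> integrable (std_gaussian d) (dF i)"
    and poly_deriv_stein: "i < d \<Longrightarrow>
      (\<integral>z. z i * F z \<partial>std_gaussian d) = (\<integral>z. dF i z \<partial>std_gaussian d)"
  using poly_deriv_stein_mon[OF assms, of "\<lambda>_. 0"] by auto

section \<open>Hermite polynomials and spiked Gaussians\<close>

text \<open>The probabilists' Hermite polynomials, monic and orthogonal for the standard Gaussian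
  weight. The truncated index at \<open>n = 0\<close> comes with the factor 0.\<close>

fun He :: "nat \<Rightarrow> real \<Rightarrow> real" where
  "He 0 x = 1"
| "He (Suc n) x = x * He n x - real n * He (n - 1) x"

definition ip :: "nat \<Rightarrow> (nat \<Rightarrow> real) \<Rightarrow> (nat \<Rightarrow> real) \<Rightarrow> real" where
  "ip d x z = (\<Sum>k<d. x k * z k)"

lemma poly_deriv_He:
  "poly_deriv d (\<lambda>z. He n (ip d x z)) (\<lambda>i z. real n * x i * He (n - 1) (ip d x z))"
proof (induction n rule: less_induct)
  case (less n)
  show ?case
  proof (cases n)
    case 0
    then show ?thesis using poly_deriv.const[of d 1] by simp
  next
    case (Suc m)
    have linear_image: "poly_deriv d (ip d x) (\<lambda>i z. x i)"
      unfolding ip_def[abs_def] by (rule poly_deriv_linear)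
    have 1: "poly_deriv d (\<lambda>z. He m (ip d x z)) (\<lambda>i z. real m * x i * He (m - 1) (ip d x z))"
      using less.IH[of m] Suc by simp
    have 2: "poly_deriv d (\<lambda>z. He (m - 1) (ip d x z))
        (\<lambda>i z. real (m - 1) * x i * He (m - 1 - 1) (ip d x z))"
      using less.IH[of "m - 1"] Suc by simp
    show ?thesis
      unfolding Suc
      by (rule poly_deriv_eqI[OF poly_deriv.add[OF poly_deriv_mult[OF linear_image 1]
          poly_deriv_scale[OF 2, of "- real m"]]];
          cases m) (auto simp: algebra_simps)
  qed
qed

text \<open>For a unit vector \<open>x\<close>, raising the Hermite index is adjoint to
  differentiating along \<open>x\<close>. Stein's identity is applied to each coordinate of
  \<open>ip d x z\<close>; the derivative that falls on \<open>He n\<close> gives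
  \<open>real n\<close> times the squared norm of \<open>x\<close> times \<open>He (n - 1)\<close>,
  which cancels the second term of the Hermite recursion.\<close>

lemma integral_He_Suc:
  assumes x: "(\<Sum>i<d. (x i)\<^sup>2) = 1" and G: "poly_deriv d G dG"
  shows "(\<integral>z. He (Suc n) (ip d x z) * G z \<partial>std_gaussian d) =
    (\<Sum>i<d. x i * (\<integral>z. He n (ip d x z) * dG i z \<partial>std_gaussian d))"
proof -
  let ?E = "\<lambda>F. \<integral>z. F z \<partial>std_gaussian d"
  have P: "poly_deriv d (\<lambda>z. He n (ip d x z) * G z)
      (\<lambda>i z. (real n * x i * He (n - 1) (ip d x z)) * G z +
    He n (ip d x z) * dG i z)" for n
    by (rule poly_deriv_mult[OF poly_deriv_He G])
  note int = poly_deriv_integrable[OF P]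
  have int1: "integrable (std_gaussian d) (\<lambda>z. z i * (He n (ip d x z) * G z))" if "i < d" for i
    using poly_deriv_integrable[OF poly_deriv.var[OF that P[of n]]] .
  have int2: "integrable (std_gaussian d) (\<lambda>z. He n (ip d x z) * dG i z)" if "i < d" for i
    using Bochner_Integration.integrable_diff[OF poly_deriv_integrable_deriv[OF P[of n] that]
        integrable_mult_right[OF int[of "n - 1"], of "real n * x i"]]
    by (simp add: algebra_simps)
  have "?E (\<lambda>z. ip d x z * (He n (ip d x z) * G z)) =
      ?E (\<lambda>z. \<Sum>i<d. x i * (z i * (He n (ip d x z) * G z)))"
    by (simp add: ip_def[of d x] sum_distrib_right mult.assoc)
  also have "\<dots> = (\<Sum>i<d. x i * ?E (\<lambda>z. z i * (He n (ip d x z) * G z)))"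
    using int1 by (subst Bochner_Integration.integral_sum) auto
  also have "\<dots> = (\<Sum>i<d. x i * (real n * x i * ?E (\<lambda>z. He (n - 1) (ip d x z) * G z) +
      ?E (\<lambda>z. He n (ip d x z) * dG i z)))"
  proof (rule sum.cong)
    fix i assume "i \<in> {..<d}"
    then have i: "i < d" by simp
    have "?E (\<lambda>z. z i * (He n (ip d x z) * G z)) =
      ?E (\<lambda>z. (real n * x i) * (He (n - 1) (ip d x z) * G z) + He n (ip d x z) * dG i z)"
      using poly_deriv_stein[OF P i, of n] by (simp add: mult.assoc)
    also have "\<dots> = real n * x i * ?E (\<lambda>z. He (n - 1) (ip d x z) * G z) +
      ?E (\<lambda>z. He n (ip d x z) * dG i z)"
      using int int2[OF i] by (subst Bochner_Integration.integral_add) auto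
    finally show "x i * ?E (\<lambda>z. z i * (He n (ip d x z) * G z)) =
      x i * (real n * x i * ?E (\<lambda>z. He (n - 1) (ip d x z) * G z) +
      ?E (\<lambda>z. He n (ip d x z) * dG i z))" by simp
  qed simp
  also have "\<dots> = (\<Sum>i<d. (x i)\<^sup>2) * (real n * ?E (\<lambda>z. He (n - 1) (ip d x z) * G z)) +
    (\<Sum>i<d. x i * ?E (\<lambda>z. He n (ip d x z) * dG i z))"
    by (simp add: algebra_simps sum.distrib sum_distrib_left sum_distrib_right power2_eq_square)
  finally have main: "?E (\<lambda>z. ip d x z * (He n (ip d x z) * G z)) =
    real n * ?E (\<lambda>z. He (n - 1) (ip d x z) * G z) +
    (\<Sum>i<d. x i * ?E (\<lambda>z. He n (ip d x z) * dG i z))" by (simp add: x)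
  have "integrable (std_gaussian d) (\<lambda>z. \<Sum>i<d. x i * (z i * (He n (ip d x z) * G z)))"
    using int1 by (intro Bochner_Integration.integrable_sum) auto
  then have int3: "integrable (std_gaussian d) (\<lambda>z. ip d x z * (He n (ip d x z) * G z))"
    by (simp add: ip_def[of d x] sum_distrib_right mult.assoc)
  have "?E (\<lambda>z. He (Suc n) (ip d x z) * G z) =
    ?E (\<lambda>z. ip d x z * (He n (ip d x z) * G z) - real n * (He (n - 1) (ip d x z) * G z))"
    by (simp add: left_diff_distrib mult.assoc)
  also have "\<dots> = ?E (\<lambda>z. ip d x z * (He n (ip d x z) * G z)) -
      real n * ?E (\<lambda>z. He (n - 1) (ip d x z) * G z)"
    using int3 int by (subst Bochner_Integration.integral_diff) auto
  finally show ?thesis by (simp add: main)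
qed

lemma prob_space_std_gaussian: "prob_space (std_gaussian d)"
  unfolding std_gaussian_def by (rule prob_space_PiM) (rule prob_space_gauss1)

text \<open>One integration by parts along \<open>x\<close> lowers both indices by one and brings
  out the factor \<open>real l * ip d x x'\<close>. When one index runs out before the other, what
  remains is the mean of a Hermite polynomial of positive degree, or a derivative of a constant, and
  this is 0.\<close>

lemma integral_He_He:
  assumes x: "(\<Sum>i<d. (x i)\<^sup>2) = 1" and x': "(\<Sum>i<d. (x' i)\<^sup>2) = 1"
  shows "(\<integral>z. He k (ip d x z) * He l (ip d x' z) \<partial>std_gaussian d) =
    (if k = l then fact k * ip d x x' ^ k else 0)"
proof (induction k arbitrary: l)
  case 0
  interpret prob_space "std_gaussian d" by (rule prob_space_std_gaussian)
  show ?case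
  proof (cases l)
    case 0
    then show ?thesis using prob_space by simp
  next
    case (Suc n)
    then show ?thesis
      using integral_He_Suc[OF x' poly_deriv.const[of d 1], of n] by simp
  qed
next
  case (Suc k)
  have "(\<integral>z. He (Suc k) (ip d x z) * He l (ip d x' z) \<partial>std_gaussian d) =
      (\<Sum>i<d. x i *
          (\<integral>z. (real l * x' i) * (He k (ip d x z) * He (l - 1) (ip d x' z)) \<partial>std_gaussian d))"
    by (subst integral_He_Suc[OF x poly_deriv_He]) (simp add: mult.assoc mult.left_commute)
  also have "\<dots> =
      ip d x x' * real l * (\<integral>z. He k (ip d x z) * He (l - 1) (ip d x' z) \<partial>std_gaussian d)"
    by (simp add: ip_def[of d x x'] sum_distrib_right sum_distrib_left algebra_simps)
  also have "\<dots> = (if Suc k = l then fact (Suc k) * ip d x x' ^ Suc k else 0)"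
    unfolding Suc.IH by (cases l) (auto simp: algebra_simps)
  finally show ?case .
qed

section \<open>Hermite expansion of the moments of a spiked Gaussian\<close>

lemma sum_decr:
  fixes e :: "nat \<Rightarrow> nat"
  assumes "i < d" "e i > 0"
  shows "Suc (\<Sum>k<d. (e(i := e i - 1)) k) = (\<Sum>k<d. e k)"
  using assms by (simp add: sum.remove[of "{..<d}" i])

lemma integral_He_Suc_mon:
  assumes x: "(\<Sum>i<d. (x i)\<^sup>2) = 1"
  shows "(\<integral>z. He (Suc n) (ip d x z) * mon d e z \<partial>std_gaussian d) =
    (\<Sum>i<d. x i * real (e i) * (\<integral>z. He n (ip d x z) * mon d (e(i := e i - 1)) z \<partial>std_gaussian d))"
  by (subst integral_He_Suc[OF x poly_deriv_mon]) (simp add: mult.assoc mult.left_commute)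

text \<open>Each integration by parts lowers the Hermite index and the degree of the monomial by
  one; the monomial is used up first.\<close>

lemma integral_He_mon_eq_0:
  assumes x: "(\<Sum>i<d. (x i)\<^sup>2) = 1" and "(\<Sum>i<d. e i) < k"
  shows "(\<integral>z. He k (ip d x z) * mon d e z \<partial>std_gaussian d) = 0"
  using assms(2)
proof (induction k arbitrary: e)
  case (Suc k)
  have "real (e i) * (\<integral>z. He k (ip d x z) * mon d (e(i := e i - 1)) z \<partial>std_gaussian d) = 0"
    if i: "i < d" for i
  proof (cases "e i = 0")
    case False
    then show ?thesis using Suc sum_decr[OF i, of e] by simp
  qed simp
  then show ?case
    by (subst integral_He_Suc_mon[OF x]) (auto simp: mult.assoc intro!: sum.neutral)
qed simp

text \<open>
  Gaussian moments satisfy the Wick recursion below, which determines them from the covariance. It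
  also covers negative spikes, for which \<open>y = z + sqrt t g x\<close> is not available.
\<close>

lemma mon_moment_unique:
  fixes M R :: "(nat \<Rightarrow> nat) \<Rightarrow> real"
  assumes "\<And>e. (\<And>i. i < d \<Longrightarrow> e i = 0) \<Longrightarrow> M e = 1"
    and "\<And>e. (\<And>i. i < d \<Longrightarrow> e i = 0) \<Longrightarrow> R e = 1"
    and M: "\<And>e i. i < d \<Longrightarrow> (\<Sum>k<d. e k) < n \<Longrightarrow>
      M (e(i := Suc (e i))) = (\<Sum>p<d. S i p * real (e p) * M (e(p := e p - 1)))"
    and R: "\<And>e i. i < d \<Longrightarrow> (\<Sum>k<d. e k) < n \<Longrightarrow>
      R (e(i := Suc (e i))) = (\<Sum>p<d. S i p * real (e p) * R (e(p := e p - 1)))"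
    and "(\<Sum>k<d. e k) \<le> n"
  shows "M e = R e"
  using assms(5)
proof (induction "\<Sum>k<d. e k" arbitrary: e rule: less_induct)
  case less
  show ?case
  proof (cases "\<forall>i<d. e i = 0")
    case True
    then show ?thesis using assms(1,2) by simp
  next
    case False
    then obtain i where i: "i < d" "e i > 0" by auto
    define e' where "e' = e(i := e i - 1)"
    have e: "e = e'(i := Suc (e' i))" using i by (auto simp: e'_def)
    have s: "Suc (\<Sum>k<d. e' k) = (\<Sum>k<d. e k)" using sum_decr[of i d e] i by (simp add: e'_def)
    \<comment> \<open>The factor \<open>real (e' p)\<close> settles exponent 0, where the truncated
      subtraction would not lower the degree and the induction hypothesis would not be about a
      smaller moment of the required kind.\<close>
    have "real (e' p) * M (e'(p := e' p - 1)) = real (e' p) * R (e'(p := e' p - 1))"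
      if p: "p < d" for p
    proof (cases "e' p = 0")
      case False
      then have "Suc (\<Sum>k<d. (e'(p := e' p - 1)) k) = (\<Sum>k<d. e' k)"
        using sum_decr[of p d e'] p by simp
      then show ?thesis using less s by simp
    qed simp
    then have "M (e'(i := Suc (e' i))) = R (e'(i := Suc (e' i)))"
      using i s less.prems by (subst M; (subst R)?) (auto simp: mult.assoc intro!: sum.cong)
    then show ?thesis using e by simp
  qed
qed

text \<open>The Wick recursion for \<open>A z\<close>: Stein's identity in the coordinates of
  \<open>z\<close> and the chain rule produce the sums \<open>\<Sum>k<d. A i k * A p k\<close>,
  which are the entries of \<open>S\<close>.\<close>

lemma integral_linear_image_mon_Suc:
  assumes A: "cov_factor d S A" and i: "i < d"
  shows "(\<integral>z. mon d (e(i := Suc (e i))) (linear_image d A z) \<partial>std_gaussian d) =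
    (\<Sum>p<d. S i p * real (e p) * (\<integral>z. mon d (e(p := e p - 1)) (linear_image d A z) \<partial>std_gaussian d))"
proof -
  let ?E = "\<lambda>F. \<integral>z. F z \<partial>std_gaussian d"
  note P = poly_deriv_linear_image[OF poly_deriv_mon, where A = A]
  have int: "integrable (std_gaussian d) (\<lambda>z. z k * mon d e (linear_image d A z))" if "k < d" for k
    using poly_deriv_integrable[OF poly_deriv.var[OF that P]] .
  have "?E (\<lambda>z. mon d (e(i := Suc (e i))) (linear_image d A z)) =
      ?E (\<lambda>z. \<Sum>k<d. A i k * (z k * mon d e (linear_image d A z)))"
    using i by (simp add: mon_Suc linear_image_def[of d A] sum_distrib_right mult.assoc)
  also have "\<dots> = (\<Sum>k<d. A i k * ?E (\<lambda>z. z k * mon d e (linear_image d A z)))"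
    using int by (subst Bochner_Integration.integral_sum) auto
  also have "\<dots> =
      (\<Sum>k<d. A i k * ?E
      (\<lambda>z. \<Sum>p<d. A p k * (real (e p) * mon d (e(p := e p - 1)) (linear_image d A z))))"
    by (intro sum.cong refl) (subst poly_deriv_stein[OF P], auto)
  also have "\<dots> =
      (\<Sum>k<d. A i k *
      (\<Sum>p<d. A p k * (real (e p) * ?E (\<lambda>z. mon d (e(p := e p - 1)) (linear_image d A z)))))"
    using poly_deriv_integrable[OF P] by (subst Bochner_Integration.integral_sum) auto
  also have "\<dots> =
      (\<Sum>p<d. (\<Sum>k<d. A i k * A p k) *
      (real (e p) * ?E (\<lambda>z. mon d (e(p := e p - 1)) (linear_image d A z))))"
    unfolding sum_distrib_left sum_distrib_right by (subst sum.swap) (simp add: mult.assoc)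
  also have "\<dots> =
      (\<Sum>p<d. S i p * (real (e p) * ?E (\<lambda>z. mon d (e(p := e p - 1)) (linear_image d A z))))"
    using A i unfolding cov_factor_def by (intro sum.cong) auto
  finally show ?thesis by (simp add: mult.assoc)
qed

text \<open>The truncated Hermite series obeys the same Wick recursion. Stein's identity for the
  extra factor \<open>z i\<close> has two parts: the derivative of the monomial yields the identity
  part of the covariance, and the derivative of \<open>He (2 * l)\<close> leaves an odd Hermite
  index, whose integration by parts along \<open>x\<close> yields the rank-one part
  \<open>t * x i * x p\<close>.\<close>

lemma hermite_expansion_mon_Suc:
  fixes t :: real
  assumes x: "(\<Sum>i<d. (x i)\<^sup>2) = 1" and i: "i < d" and e: "(\<Sum>k<d. e k) \<le> 2 * L"
  defines "R \<equiv> \<lambda>e. \<Sum>l\<le>L. (t / 2) ^ l / fact l *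
      (\<integral>z. He (2 * l) (ip d x z) * mon d e z \<partial>std_gaussian d)"
  shows "R (e(i := Suc (e i))) = (\<Sum>p<d. spiked_cov t x i p * real (e p) * R (e(p := e p - 1)))"
proof -
  let ?E = "\<lambda>F. \<integral>z. F z \<partial>std_gaussian d"
  define h where "h k e = ?E (\<lambda>z. He k (ip d x z) * mon d e z)" for k e
  have P: "poly_deriv d (\<lambda>z. He n (ip d x z) * mon d e z)
      (\<lambda>i z. (real n * x i * He (n - 1) (ip d x z)) * mon d e z +
    He n (ip d x z) * (real (e i) * mon d (e(i := e i - 1)) z))" for n e
    by (rule poly_deriv_mult[OF poly_deriv_He poly_deriv_mon])
  note int = poly_deriv_integrable[OF P]
  have step: "h n (e(i := Suc (e i))) =
      real n * x i * h (n - 1) e + real (e i) * h n (e(i := e i - 1))" for n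
  proof -
    have "h n (e(i := Suc (e i))) = ?E (\<lambda>z. z i * (He n (ip d x z) * mon d e z))"
      using i by (simp add: h_def mon_Suc mult.left_commute)
    also have "\<dots> = ?E (\<lambda>z. real n * x i * (He (n - 1) (ip d x z) * mon d e z) +
      real (e i) * (He n (ip d x z) * mon d (e(i := e i - 1)) z))"
      by (subst poly_deriv_stein[OF P i]) (simp add: mult.assoc mult.left_commute)
    also have "\<dots> = real n * x i * h (n - 1) e + real (e i) * h n (e(i := e i - 1))"
      unfolding h_def using int by (subst Bochner_Integration.integral_add) auto
    finally show ?thesis .
  qed
  define c where "c l = (t / 2) ^ l / fact l" for l :: nat
  \<comment> \<open>The coefficients are made for this: differentiating the term
    \<open>Suc l\<close> produces \<open>t\<close> times the coefficient of the term
    \<open>l\<close>.\<close>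
  have c: "c (Suc l) * real (2 * Suc l) = t * c l" for l
  proof -
    have "c (Suc l) * real (2 * Suc l) =
        (2 * real (Suc l)) * ((t / 2) ^ Suc l) / ((2 * real (Suc l)) * (fact l / 2))"
      unfolding c_def by (simp only: fact_Suc of_nat_mult of_nat_numeral) (simp add: mult_ac)
    also have "\<dots> = t * c l"
      by (subst mult_divide_mult_cancel_left) (auto simp: c_def)
    finally show ?thesis .
  qed
  define T where "T l = (\<Sum>p<d. x p * real (e p) * h (2 * l) (e(p := e p - 1)))" for l
  have T: "h (Suc (2 * l)) e = T l" for l
    unfolding h_def T_def by (rule integral_He_Suc_mon[OF x])
  \<comment> \<open>The index shift reaches only the terms below \<open>L\<close>. The missing one
    pairs \<open>He (2 * L)\<close> with monomials of degree less than \<open>2 * L\<close>, so it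
    can be added for free.\<close>
  have TL: "T L = 0"
  proof -
    have "real (e p) * h (2 * L) (e(p := e p - 1)) = 0" if p: "p < d" for p
    proof (cases "e p = 0")
      case False
      then have "Suc (\<Sum>k<d. (e(p := e p - 1)) k) = (\<Sum>k<d. e k)" using sum_decr[of p d e] p by simp
      then show ?thesis unfolding h_def using e by (subst integral_He_mon_eq_0[OF x]) auto
    qed simp
    then show ?thesis by (auto simp: T_def mult.assoc intro!: sum.neutral)
  qed
  have "(\<Sum>l\<le>L. c l * (real (2 * l) * x i * h (2 * l - 1) e)) = (\<Sum>l\<le>L. t * x i * c l * T l)"
  proof -
    \<comment> \<open>The term \<open>l = 0\<close> has the factor \<open>real (2 * l) = 0\<close>,
      so the sum may start at 1 and be shifted.\<close>
    have "(\<Sum>l\<le>L. c l * (real (2 * l) * x i * h (2 * l - 1) e)) =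
        (\<Sum>l<L. c (Suc l) * (real (2 * Suc l) * x i * h (2 * Suc l - 1) e))"
      by (simp add: lessThan_Suc_atMost[symmetric] sum.lessThan_Suc_shift del: sum.lessThan_Suc)
    also have "\<dots> = (\<Sum>l<L. t * x i * c l * T l)"
    proof (intro sum.cong refl)
      fix l
      have "c (Suc l) * (real (2 * Suc l) * x i * h (2 * Suc l - 1) e) =
        (c (Suc l) * real (2 * Suc l)) * x i * T l" by (simp add: T)
      then show "c (Suc l) * (real (2 * Suc l) * x i * h (2 * Suc l - 1) e) = t * x i * c l * T l"
        unfolding c by simp
    qed
    finally show ?thesis by (simp add: lessThan_Suc_atMost[symmetric] TL)
  qed
  moreover have "R (e(i := Suc (e i))) = (\<Sum>l\<le>L. c l * (real (2 * l) * x i * h (2 * l - 1) e)) +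
      real (e i) * R (e(i := e i - 1))"
    unfolding R_def h_def[symmetric] c_def[symmetric] step
    by (simp add: distrib_left sum.distrib sum_distrib_left mult.left_commute)
  moreover have "(\<Sum>l\<le>L. t * x i * c l * T l) =
      (\<Sum>p<d. t * x i * x p * real (e p) * R (e(p := e p - 1)))"
    unfolding T_def R_def h_def[symmetric] c_def[symmetric] sum_distrib_left
    by (subst sum.swap) (simp add: mult.assoc mult.left_commute)
  moreover have "(\<Sum>p<d. spiked_cov t x i p * real (e p) * R (e(p := e p - 1))) =
     (\<Sum>p<d. (if p = i then real (e i) * R (e(i := e i - 1)) else 0) +
        t * x i * x p * real (e p) * R (e(p := e p - 1)))"
    by (rule sum.cong) (auto simp: spiked_cov_def algebra_simps)
  ultimately show ?thesis
    using i by (simp add: sum.distrib)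
qed

text \<open>Both sides are 1 for the trivial monomial and obey the Wick recursion up to degree
  \<open>2 * L\<close>. The truncated series is therefore exact for these moments, and no
  convergence of the full series enters.\<close>

lemma integral_linear_image_mon:
  assumes x: "(\<Sum>i<d. (x i)\<^sup>2) = 1" and A: "cov_factor d (spiked_cov t x) A"
    and e: "(\<Sum>k<d. e k) \<le> 2 * L"
  shows "(\<integral>z. mon d e (linear_image d A z) \<partial>std_gaussian d) =
    (\<Sum>l\<le>L. (t / 2) ^ l / fact l * (\<integral>z. He (2 * l) (ip d x z) * mon d e z \<partial>std_gaussian d))"
proof (rule mon_moment_unique[OF _ _ _ _ e])
  interpret prob_space "std_gaussian d" by (rule prob_space_std_gaussian)
  fix e :: "nat \<Rightarrow> nat"
  assume e: "\<And>i. i < d \<Longrightarrow> e i = 0"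
  then have m: "mon d e = (\<lambda>_. 1)" by (auto simp: mon_def fun_eq_iff)
  show "(\<integral>z. mon d e (linear_image d A z) \<partial>std_gaussian d) = 1"
    using prob_space by (simp add: m)
  have "(\<integral>z. He (2 * l) (ip d x z) * mon d e z \<partial>std_gaussian d) = (if l = 0 then 1 else 0)" for l
    using e integral_He_mon_eq_0[OF x, of e "2 * l"] prob_space by (auto simp: m)
  then show "(\<Sum>l\<le>L. (t / 2) ^ l / fact l *
      (\<integral>z. He (2 * l) (ip d x z) * mon d e z \<partial>std_gaussian d)) = 1"
    by (simp add: if_distrib[of "\<lambda>x. _ * x"] cong: if_cong)
next
  fix e :: "nat \<Rightarrow> nat" and i
  assume i: "i < d" and e: "(\<Sum>k<d. e k) < 2 * L"
  show "(\<integral>z. mon d (e(i := Suc (e i))) (linear_image d A z) \<partial>std_gaussian d) =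
    (\<Sum>p<d. spiked_cov t x i p * real (e p) *
      (\<integral>z. mon d (e(p := e p - 1)) (linear_image d A z) \<partial>std_gaussian d))"
    by (rule integral_linear_image_mon_Suc[OF A i])
  show "(\<Sum>l\<le>L. (t / 2) ^ l / fact l *
        (\<integral>z. He (2 * l) (ip d x z) * mon d (e(i := Suc (e i))) z \<partial>std_gaussian d)) =
    (\<Sum>p<d. spiked_cov t x i p * real (e p) * (\<Sum>l\<le>L. (t / 2) ^ l / fact l *
        (\<integral>z. He (2 * l) (ip d x z) * mon d (e(p := e p - 1)) z \<partial>std_gaussian d)))"
    using hermite_expansion_mon_Suc[OF x i] e by (simp only: less_imp_le)
qed

section \<open>Averages over spikes and signs\<close>

lemma power_le_fact_exp:
  fixes v :: real
  assumes "v \<ge> 0"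
  shows "v ^ n \<le> fact n * exp v"
proof -
  have "(\<Sum>k\<in>{n}. v ^ k /\<^sub>R fact k) \<le> (\<Sum>k. v ^ k /\<^sub>R fact k)"
    using assms by (intro sum_le_suminf summable_exp_generic) auto
  then show ?thesis
    by (simp add: exp_def field_simps)
qed

text \<open>Multiplying out \<open>(1 + y + y\<^sup>2 / 2) * (1 - y + y\<^sup>2) \<ge> 1\<close>
  gives \<open>exp (- y) \<le> 1 - y + y\<^sup>2\<close>. Added to
  \<open>exp y \<le> 1 + y + y\<^sup>2\<close>, the linear terms cancel. The exponent is twice the
  optimal one, which costs only a constant later.\<close>

lemma cosh_le_exp_square:
  fixes y :: real
  assumes "0 \<le> y" "y \<le> 1"
  shows "exp y + exp (- y) \<le> 2 * exp (y\<^sup>2)"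
proof -
  have "(1 + y + y\<^sup>2 / 2) * (1 - y + y\<^sup>2) = 1 + (y\<^sup>2 + y ^ 3 + y ^ 4) / 2"
    by (simp add: power2_eq_square power3_eq_cube power4_eq_xxxx field_simps)
  then have "1 \<le> (1 + y + y\<^sup>2 / 2) * (1 - y + y\<^sup>2)"
    using assms by simp
  also have "\<dots> \<le> exp y * (1 - y + y\<^sup>2)"
    using assms exp_lower_Taylor_quadratic[of y] by (intro mult_right_mono) auto
  finally have "exp (- y) \<le> 1 - y + y\<^sup>2"
    by (simp add: exp_minus field_simps)
  moreover have "exp y \<le> 1 + y + y\<^sup>2"
    using exp_bound[of y] assms by simp
  moreover have "1 + y\<^sup>2 \<le> exp (y\<^sup>2)"
    by (rule exp_ge_add_one_self)
  ultimately show ?thesis by linarith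
qed

section \<open>Moments of the overlap of two random spikes\<close>

abbreviation spikes :: "nat \<Rightarrow> (nat \<Rightarrow> real) set" where
  "spikes d \<equiv> {..<d} \<rightarrow>\<^sub>E {1 / sqrt (real d), - (1 / sqrt (real d))}"

abbreviation signs :: "nat \<Rightarrow> (nat \<Rightarrow> real) set" where
  "signs d \<equiv> {..<d} \<rightarrow>\<^sub>E {1, -1}"

lemma card_spikes: "d > 0 \<Longrightarrow> card (spikes d) = 2 ^ d"
  by (subst card_funcsetE) (auto simp: numeral_2_eq_2)

lemma card_signs: "card (signs d) = 2 ^ d"
  by (subst card_funcsetE) (auto simp: numeral_2_eq_2)

lemma spikes_unit: "d > 0 \<Longrightarrow> x \<in> spikes d \<Longrightarrow> (\<Sum>i<d. (x i)\<^sup>2) = 1"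
proof -
  assume d: "d > 0" and x: "x \<in> spikes d"
  have "(x i)\<^sup>2 = 1 / real d" if "i < d" for i
  proof -
    have "x i \<in> {1 / sqrt (real d), - (1 / sqrt (real d))}" using x that by (auto dest: PiE_mem)
    then show ?thesis by (auto simp: power_divide)
  qed
  then show ?thesis using d by simp
qed

text \<open>The exponential factors over the coordinates. At the scale \<open>sqrt (real d)\<close>
  each coordinate contributes \<open>exp r + exp (- r)\<close> with
  \<open>r = 1 / sqrt (real d)\<close>, whatever the signs of \<open>x i\<close> and
  \<open>c\<close>. This is at most \<open>2 * exp (1 / real d)\<close>, and \<open>d\<close> such
  factors give \<open>exp 1\<close>.\<close>

lemma sum_spikes_exp_ip:
  assumes d: "d > 0" and x: "x \<in> spikes d" and c: "c = sqrt (real d) \<or> c = - sqrt (real d)"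
  shows "(\<Sum>x'\<in>spikes d. exp (c * ip d x x')) \<le> 2 ^ d * exp 1"
proof -
  define r where "r = 1 / sqrt (real d)"
  have r: "0 < r" "r \<le> 1" "r\<^sup>2 = 1 / real d" using d by (auto simp: r_def power_divide)
  have "(\<Sum>x'\<in>spikes d. exp (c * ip d x x')) = (\<Sum>x'\<in>spikes d. \<Prod>i<d. exp (c * (x i * x' i)))"
    by (simp add: ip_def sum_distrib_left exp_sum)
  also have "\<dots> = (\<Prod>i<d. \<Sum>a\<in>{r, - r}. exp (c * (x i * a)))"
    by (subst prod_sum_PiE) (auto simp: r_def)
  also have "\<dots> = (\<Prod>i<d. exp r + exp (- r))"
  proof (rule prod.cong)
    fix i assume "i \<in> {..<d}"
    then have xi: "x i = r \<or> x i = - r" using x by (auto simp: r_def dest: PiE_mem)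
    have "sqrt (real d) * r = 1" using d by (simp add: r_def)
    then have "sqrt (real d) * (r * r) = r" by (simp flip: mult.assoc)
    then have "c * (x i * r) = r \<or> c * (x i * r) = - r"
      using xi c by (elim disjE)
          (simp_all only: mult_minus_left mult_minus_right minus_minus, simp_all)
    then have "exp (c * (x i * r)) + exp (- (c * (x i * r))) = exp r + exp (- r)"
      by (elim disjE) (simp_all only: minus_minus add.commute)
    then show "(\<Sum>a\<in>{r, - r}. exp (c * (x i * a))) = exp r + exp (- r)"
      using r(1) by simp
  qed simp
  also have "\<dots> \<le> (\<Prod>i<d. 2 * exp (r\<^sup>2))"
    using cosh_le_exp_square[of r] r by (intro prod_mono) (auto intro: add_nonneg_nonneg)
  also have "\<dots> = 2 ^ d * exp 1"
    using d by (simp add: power_mult_distrib r exp_of_nat_mult[symmetric])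
  finally show ?thesis .
qed

text \<open>With \<open>v = sqrt (real d) * ip d x x'\<close>, a single term of the exponential
  series bounds \<open>v ^ (2 * p)\<close> by \<open>fact (2 * p) * exp \<bar>v\<bar>\<close>, and
  \<open>exp \<bar>v\<bar> \<le> exp v + exp (- v)\<close>. The constant 6 is
  \<open>2 * exp 1\<close> rounded up.\<close>

lemma sum_spikes_ip_power:
  assumes d: "d > 0" and x: "x \<in> spikes d"
  shows "(\<Sum>x'\<in>spikes d. ip d x x' ^ (2 * p)) \<le> 6 * fact (2 * p) / real d ^ p * 2 ^ d"
proof -
  let ?c = "sqrt (real d)"
  have fin: "finite (spikes d)" by (intro finite_PiE) auto
  have "real d ^ p * ip d x x' ^ (2 * p) \<le>
      fact (2 * p) * (exp (?c * ip d x x') + exp (- ?c * ip d x x'))" for x'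
  proof -
    have "real d ^ p * ip d x x' ^ (2 * p) = \<bar>?c * ip d x x'\<bar> ^ (2 * p)"
      by (simp add: power_mult_distrib power_mult)
    also have "\<dots> \<le> fact (2 * p) * exp \<bar>?c * ip d x x'\<bar>"
      by (rule power_le_fact_exp) simp
    also have "\<dots> \<le> fact (2 * p) * (exp (?c * ip d x x') + exp (- ?c * ip d x x'))"
      by (intro mult_left_mono) (auto simp: abs_if)
    finally show ?thesis .
  qed
  then have "(\<Sum>x'\<in>spikes d. real d ^ p * ip d x x' ^ (2 * p)) \<le>
      (\<Sum>x'\<in>spikes d. fact (2 * p) * (exp (?c * ip d x x') + exp (- ?c * ip d x x')))"
    by (intro sum_mono) auto
  also have "\<dots> = fact (2 * p) * ((\<Sum>x'\<in>spikes d. exp (?c * ip d x x')) +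
      (\<Sum>x'\<in>spikes d. exp (- ?c * ip d x x')))"
    by (simp add: sum_distrib_left sum.distrib distrib_left)
  also have "\<dots> \<le> fact (2 * p) * (2 ^ d * exp 1 + 2 ^ d * exp 1)"
    using sum_spikes_exp_ip[OF d x, of ?c] sum_spikes_exp_ip[OF d x, of "- ?c"]
    by (intro mult_left_mono add_mono) auto
  also have "\<dots> \<le> fact (2 * p) * (6 * 2 ^ d)"
    using exp_le by (intro mult_left_mono) auto
  finally show ?thesis
    using d by (simp add: sum_distrib_left[symmetric] field_simps)
qed

section \<open>Sign averages and the count of surviving profiles\<close>

definition block_sum :: "nat \<Rightarrow> nat \<Rightarrow> (nat \<Rightarrow> nat) \<Rightarrow> nat \<Rightarrow> nat" where
  "block_sum d m l b = (\<Sum>j\<in>{j\<in>{..<m * d}. j div m = b}. l j)"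

lemma div_less_blocks: "j < m * d \<Longrightarrow> j div m < (d :: nat)"
  by (simp add: less_mult_imp_div_less mult.commute)

text \<open>Grouping the factors by block raises \<open>s b\<close> to the block sum, and an odd
  power sums to 0 over the two signs.\<close>

lemma sum_signs_prod:
  "(\<Sum>s\<in>signs d. \<Prod>j<m * d. s (j div m) ^ l j) =
    (if \<forall>b<d. even (block_sum d m l b) then 2 ^ d else 0)"
proof -
  have "(\<Prod>j<m * d. s (j div m) ^ l j) = (\<Prod>b<d. s b ^ block_sum d m l b)" for s :: "nat \<Rightarrow> real"
  proof -
    have "(\<Prod>j<m * d. s (j div m) ^ l j) =
        (\<Prod>b<d. \<Prod>j\<in>{j\<in>{..<m * d}. j div m = b}. s (j div m) ^ l j)"
      by (rule prod.group[symmetric]) (auto intro: div_less_blocks)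
    also have "\<dots> = (\<Prod>b<d. s b ^ block_sum d m l b)"
      unfolding block_sum_def power_sum by (intro prod.cong) auto
    finally show ?thesis .
  qed
  then have "(\<Sum>s\<in>signs d. \<Prod>j<m * d. s (j div m) ^ l j) =
      (\<Prod>b<d. \<Sum>a\<in>{1, -1 :: real}. a ^ block_sum d m l b)"
    by (subst prod_sum_PiE) auto
  also have "\<dots> = (\<Prod>b<d. if even (block_sum d m l b) then 2 else 0)"
    by (intro prod.cong) auto
  also have "\<dots> = (if \<forall>b<d. even (block_sum d m l b) then 2 ^ d else 0)"
    by (auto simp: prod_zero_iff)
  finally show ?thesis .
qed

text \<open>The profiles of total \<open>2 k\<close> that survive the average over the signs.\<close>

definition even_profiles :: "nat \<Rightarrow> nat \<Rightarrow> nat \<Rightarrow> (nat \<Rightarrow> nat) set" where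
  "even_profiles d m k = {l \<in> {..<m * d} \<rightarrow>\<^sub>E UNIV. (\<Sum>j<m * d. l j) = 2 * k \<and>
      (\<forall>b<d. even (block_sum d m l b))}"

lemma block_sum_upd:
  assumes "j < m * d"
  shows "block_sum d m (l(j := Suc (l j))) b = block_sum d m l b + (if b = j div m then 1 else 0)"
proof (cases "b = j div m")
  case True
  then show ?thesis
    using assms by (auto simp: block_sum_def sum.remove[of _ j] intro!: sum.cong)
next
  case False
  then show ?thesis by (auto simp: block_sum_def intro!: sum.cong)
qed

lemma sum_upd_Suc:
  fixes l :: "nat \<Rightarrow> nat"
  assumes "j < n"
  shows "(\<Sum>i<n. (l(j := Suc (l j))) i) = Suc (\<Sum>i<n. l i)"
  using assms by (simp add: sum.remove[of "{..<n}" j])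

text \<open>
  A block with a positive entry has sum at least 2, so a profile of total \<open>2 (k + 1)\<close> is obtained
  from one of total \<open>2 k\<close> by two increments in the same block.
\<close>

lemma even_profiles_card:
  "finite (even_profiles d m k) \<and> card (even_profiles d m k) \<le> (d * m\<^sup>2) ^ k"
proof (induction k)
  case 0
  have "even_profiles d m 0 \<subseteq> {\<lambda>j\<in>{..<m * d}. 0}"
    by (auto simp: even_profiles_def PiE_def extensional_def fun_eq_iff)
  then show ?case
    using card_mono[of "{\<lambda>j\<in>{..<m * d}. 0}" "even_profiles d m 0"] by (auto intro: finite_subset)
next
  case (Suc k)
  define inc where "inc = (\<lambda>j (l :: nat \<Rightarrow> nat). l(j := Suc (l j)))"
  \<comment> \<open>A triple encodes a block and two positions in it, possibly equal. These are
    \<open>d * m\<^sup>2\<close> choices for each step from \<open>k\<close> to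
    \<open>Suc k\<close>.\<close>
  define T where "T = ({..<d} \<times> {..<m} \<times> {..<m}) \<times> even_profiles d m k"
  have T: "finite T" "card T \<le> (d * m\<^sup>2) ^ Suc k"
    using Suc by (auto simp: T_def card_cartesian_product power2_eq_square mult_le_mono)
  have "even_profiles d m (Suc k) \<subseteq> (\<lambda>((b, i, i'), l). inc (b * m + i) (inc (b * m + i') l)) ` T"
  proof
    fix l assume l: "l \<in> even_profiles d m (Suc k)"
    then have sum: "(\<Sum>j<m * d. l j) = 2 * Suc k" and ev: "\<And>b. b < d \<Longrightarrow> even (block_sum d m l b)"
      and ext: "l \<in> {..<m * d} \<rightarrow>\<^sub>E UNIV"
      by (auto simp: even_profiles_def)
    obtain j where j: "j < m * d" "l j > 0"
    proof -
      have "(\<Sum>j<m * d. l j) \<noteq> 0" using sum by simp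
      then show ?thesis using that by (metis sum.neutral lessThan_iff bot_nat_0.not_eq_extremum)
    qed
    define b where "b = j div m"
    have b: "b < d" using j by (simp add: b_def div_less_blocks)
    define l1 where "l1 = l(j := l j - 1)"
    have l1: "l = inc j l1" using j by (auto simp: inc_def l1_def)
    \<comment> \<open>Parity supplies the second decrement: after the first one the sum of this
      block is odd, hence nonzero, so a positive entry is left. It may be the same entry
      \<open>j\<close>.\<close>
    have "even (Suc (block_sum d m l1 b))"
      using ev[OF b] block_sum_upd[OF j(1), of l1 b] by (simp add: l1 inc_def b_def)
    then have "block_sum d m l1 b \<noteq> 0" by (metis even_Suc even_zero)
    then obtain j' where j': "j' < m * d" "j' div m = b" "l1 j' > 0"
      unfolding block_sum_def using sum.neutral[of "{j \<in> {..<m * d}. j div m = b}" l1] by auto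
    define l2 where "l2 = l1(j' := l1 j' - 1)"
    have l2: "l1 = inc j' l2" using j' by (auto simp: inc_def l2_def)
    have "block_sum d m l c = block_sum d m l2 c + (if c = b then 2 else 0)" for c
      using block_sum_upd[OF j(1), of l1 c] block_sum_upd[OF j'(1), of l2 c] j'(2)
      by (simp add: l1[unfolded inc_def] l2[unfolded inc_def] b_def)
    then have "even (block_sum d m l2 c)" if "c < d" for c
      using ev[OF that] by (auto split: if_splits)
    moreover have "(\<Sum>j<m * d. l2 j) = 2 * k"
      using sum sum_upd_Suc[OF j(1), of l1] sum_upd_Suc[OF j'(1), of l2]
      unfolding l1[unfolded inc_def, symmetric] l2[unfolded inc_def, symmetric] by simp
    moreover have "l2 \<in> {..<m * d} \<rightarrow>\<^sub>E UNIV"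
      using ext j(1) j'(1) by (auto simp: l2_def l1_def PiE_def extensional_def)
    ultimately have "l2 \<in> even_profiles d m k" by (auto simp: even_profiles_def)
    moreover have m: "m > 0" using j(1) by (cases m) auto
    ultimately have "((b, j mod m, j' mod m), l2) \<in> T" using b by (auto simp: T_def)
    moreover have "l =
        (\<lambda>((b, i, i'), l). inc (b * m + i) (inc (b * m + i') l)) ((b, j mod m, j' mod m), l2)"
    proof -
      have "b * m + j mod m = j" "b * m + j' mod m = j'"
        using div_mult_mod_eq[of j m] div_mult_mod_eq[of j' m] j'(2) by (simp_all add: b_def)
      then show ?thesis using l1 l2 by simp
    qed
    ultimately show "l \<in> (\<lambda>((b, i, i'), l). inc (b * m + i) (inc (b * m + i') l)) ` T"
      by (rule rev_image_eqI)
  qed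
  then show ?case
    using T surj_card_le[OF T(1)] finite_surj[OF T(1)] by (meson order_trans)
qed

text \<open>The central binomial coefficient of \<open>2 * l\<close> divided by
  \<open>4 ^ l\<close>. It is the part independent of the spikes when the norm
  \<open>fact (2 * l)\<close> of \<open>He (2 * l)\<close> is multiplied by two expansion
  coefficients.\<close>

definition hermite_weight :: "nat \<Rightarrow> real" where
  "hermite_weight l = fact (2 * l) / (4 ^ l * (fact l)\<^sup>2)"

text \<open>Passing from \<open>l\<close> to \<open>Suc l\<close> multiplies the weight by (2l + 1)
  / (2l + 2), which is at most 1.\<close>

lemma hermite_weight_bounds: "0 \<le> hermite_weight l" "hermite_weight l \<le> 1"
proof -
  show "0 \<le> hermite_weight l" by (simp add: hermite_weight_def)
  have "(fact (2 * l) :: real) \<le> 4 ^ l * (fact l)\<^sup>2"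
  proof (induction l)
    case (Suc l)
    have "(fact (2 * Suc l) :: real) = ((2 * real l + 2) * (2 * real l + 1)) * fact (2 * l)"
      by (simp add: algebra_simps)
    also have "\<dots> \<le> (4 * (real l + 1)\<^sup>2) * (4 ^ l * (fact l)\<^sup>2)"
      by (rule mult_mono) (use Suc in \<open>auto simp: power2_eq_square algebra_simps\<close>)
    also have "\<dots> = 4 ^ Suc l * (fact (Suc l))\<^sup>2"
      by (simp add: power2_eq_square algebra_simps)
    finally show ?case .
  qed simp
  then show "hermite_weight l \<le> 1" by (simp add: hermite_weight_def divide_le_eq)
qed

text \<open>A profile \<open>l\<close> selects the term \<open>He (2 * l j)\<close> for the vector
  \<open>j\<close>, so \<open>2 * (\<Sum>j<n. l j)\<close> is the total degree of the selected
  product. The range \<open>{..D}\<close> makes the set finite and matches the sums over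
  \<open>{..D}\<close> that are multiplied out over the vectors.\<close>

definition profiles :: "nat \<Rightarrow> nat \<Rightarrow> (nat \<Rightarrow> nat) set" where
  "profiles n D = {l \<in> {..<n} \<rightarrow>\<^sub>E {..D}. 2 * (\<Sum>j<n. l j) \<le> D}"

definition zero_profile :: "nat \<Rightarrow> nat \<Rightarrow> nat" where
  "zero_profile n = (\<lambda>j\<in>{..<n}. 0)"

lemma finite_profiles: "finite (profiles n D)"
  unfolding profiles_def by (rule finite_subset[of _ "{..<n} \<rightarrow>\<^sub>E {..D}"]) (auto intro: finite_PiE)

text \<open>The left side is the squared null norm of the nonconstant part of the truncated
  likelihood ratio, written with two independent prior draws. The two sign sums leave only profiles
  with even block sums, the weights are at most 1, and the overlap moments together with the count
  of profiles give a geometric series. The assumption on the ratio bounds that series by twice its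
  first term, and 12 is 2 times the 6 from the overlap moments.\<close>

lemma second_moment_bound:
  fixes lam :: real
  assumes d: "d > 0" and q: "real D ^ 4 * (real m)\<^sup>2 * lam ^ 4 / real d \<le> 1 / 2"
  shows "(\<Sum>x\<in>spikes d. \<Sum>s\<in>signs d. \<Sum>x'\<in>spikes d. \<Sum>s'\<in>signs d.
      \<Sum>l\<in>profiles (m * d) D - {zero_profile (m * d)}.
        \<Prod>j<m * d. hermite_weight (l j) * (s (j div m) * s' (j div m) * lam\<^sup>2 *
            (ip d x x')\<^sup>2) ^ l j) / (4 ^ d)\<^sup>2
    \<le> 12 * (real D ^ 4 * (real m)\<^sup>2 * lam ^ 4 / real d)"
    (is "?L / _ \<le> 12 * ?q")
proof -
  let ?P = "profiles (m * d) D - {zero_profile (m * d)}"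
  have finX: "finite (spikes d)" by (intro finite_PiE) auto
  define W where "W l = (\<Prod>j<m * d. hermite_weight (l j))" for l :: "nat \<Rightarrow> nat"
  define S where "S l = (\<Sum>j<m * d. l j)" for l :: "nat \<Rightarrow> nat"
  define M where "M p = (\<Sum>x\<in>spikes d. \<Sum>x'\<in>spikes d. ip d x x' ^ p)" for p :: nat
  define ev where "ev l \<longleftrightarrow> (\<forall>b<d. even (block_sum d m l b))" for l
  have W: "0 \<le> W l" "W l \<le> 1" for l
    unfolding W_def by (auto intro!: prod_nonneg prod_le_1 hermite_weight_bounds)
  have p2: "(a\<^sup>2) ^ n = (a ^ n)\<^sup>2" for a :: real and n
    by (simp add: power_mult[symmetric] mult.commute)
  have "(\<Prod>j<m * d. hermite_weight (l j) * (s (j div m) * s' (j div m) * lam\<^sup>2 *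
      (ip d x x')\<^sup>2) ^ l j)
      = W l * (lam ^ (2 * S l) * (ip d x x' ^ (2 * S l) *
        ((\<Prod>j<m * d. s (j div m) ^ l j) * (\<Prod>j<m * d. s' (j div m) ^ l j))))" for l x x' s s'
    unfolding W_def S_def
    by (simp add: prod.distrib power_mult_distrib power_sum power_mult sum_distrib_left p2 mult_ac)
  then have "?L = (\<Sum>x\<in>spikes d. \<Sum>s\<in>signs d. \<Sum>x'\<in>spikes d. \<Sum>s'\<in>signs d. \<Sum>l\<in>?P.
      W l * (lam ^ (2 * S l) * (ip d x x' ^ (2 * S l) *
        ((\<Prod>j<m * d. s (j div m) ^ l j) * (\<Prod>j<m * d. s' (j div m) ^ l j)))))" by simp
  also have "\<dots> = (\<Sum>l\<in>?P. \<Sum>x\<in>spikes d. \<Sum>s\<in>signs d. \<Sum>x'\<in>spikes d. \<Sum>s'\<in>signs d.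
      W l * (lam ^ (2 * S l) * (ip d x x' ^ (2 * S l) *
        ((\<Prod>j<m * d. s (j div m) ^ l j) * (\<Prod>j<m * d. s' (j div m) ^ l j)))))"
    by (simp add: sum.swap[where B = ?P])
  also have "\<dots> = (\<Sum>l\<in>?P. W l * (lam ^ (2 * S l) * (M (2 * S l) *
      (if ev l then (2 ^ d)\<^sup>2 else 0))))"
  proof (rule sum.cong)
    fix l
    have "(\<Sum>x\<in>spikes d. \<Sum>s\<in>signs d. \<Sum>x'\<in>spikes d. \<Sum>s'\<in>signs d.
      W l * (lam ^ (2 * S l) * (ip d x x' ^ (2 * S l) *
        ((\<Prod>j<m * d. s (j div m) ^ l j) * (\<Prod>j<m * d. s' (j div m) ^ l j))))) =
      (\<Sum>x\<in>spikes d. \<Sum>s\<in>signs d. \<Sum>x'\<in>spikes d.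
      W l * (lam ^ (2 * S l) * (ip d x x' ^ (2 * S l) *
        ((\<Prod>j<m * d. s (j div m) ^ l j) * (if ev l then 2 ^ d else 0)))))"
      unfolding ev_def sum_signs_prod[symmetric] sum_distrib_left ..
    also have "\<dots> = (\<Sum>x\<in>spikes d. \<Sum>x'\<in>spikes d. \<Sum>s\<in>signs d.
      W l * (lam ^ (2 * S l) * (ip d x x' ^ (2 * S l) *
        ((\<Prod>j<m * d. s (j div m) ^ l j) * (if ev l then 2 ^ d else 0)))))"
      by (intro sum.cong refl sum.swap)
    also have "\<dots> = (\<Sum>x\<in>spikes d. \<Sum>x'\<in>spikes d. W l * (lam ^ (2 * S l) * (ip d x x' ^ (2 * S l) *
        ((if ev l then 2 ^ d else 0) * (if ev l then 2 ^ d else 0)))))"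
      unfolding sum_distrib_left[symmetric] sum_distrib_right[symmetric] sum_signs_prod ev_def ..
    finally show "(\<Sum>x\<in>spikes d. \<Sum>s\<in>signs d. \<Sum>x'\<in>spikes d. \<Sum>s'\<in>signs d.
      W l * (lam ^ (2 * S l) * (ip d x x' ^ (2 * S l) *
        ((\<Prod>j<m * d. s (j div m) ^ l j) * (\<Prod>j<m * d. s' (j div m) ^ l j))))) =
      W l * (lam ^ (2 * S l) * (M (2 * S l) * (if ev l then (2 ^ d)\<^sup>2 else 0)))"
      by (auto simp: M_def sum_distrib_left[symmetric] sum_distrib_right[symmetric]
          power2_eq_square)
  qed simp
  also have "\<dots> = (\<Sum>l\<in>{l\<in>?P. ev l}. W l * (lam ^ (2 * S l) * M (2 * S l)) * 4 ^ d)"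
    using p2[of 2 d] by (subst sum.inter_filter)
        (auto simp: finite_profiles mult.assoc split: if_splits intro!: sum.cong)
  \<comment> \<open>Each surviving term is bounded by a quantity depending on its total only, and
    the index set grows to all even profiles of total \<open>2 * k\<close>. The range of
    \<open>k\<close> starts at 1 because the zero profile has been removed.\<close>
  also have "\<dots> \<le>
      (\<Sum>l\<in>(\<Union>k\<in>{1..D}. even_profiles d m k). 6 * (real D ^ 4 * lam ^ 4 / (real d)\<^sup>2) ^
      (S l div 2) * (4 ^ d)\<^sup>2)"
  proof (rule sum_le_included[where i = "\<lambda>l. l"])
    show "finite {l \<in> ?P. ev l}" by (simp add: finite_profiles)
    show "finite (\<Union>k\<in>{1..D}. even_profiles d m k)" using even_profiles_card by blast
    show "\<forall>l\<in>\<Union>k\<in>{1..D}. even_profiles d m k.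
        0 \<le> 6 * (real D ^ 4 * lam ^ 4 / (real d)\<^sup>2) ^ (S l div 2) * (4 ^ d)\<^sup>2"
      by auto
    show "\<forall>l\<in>{l \<in> ?P. ev l}. \<exists>l'\<in>\<Union>k\<in>{1..D}. even_profiles d m k. l' = l \<and>
      W l * (lam ^ (2 * S l) * M (2 * S l)) * 4 ^ d \<le>
        6 * (real D ^ 4 * lam ^ 4 / (real d)\<^sup>2) ^ (S l' div 2) * (4 ^ d)\<^sup>2"
    proof
      fix l assume "l \<in> {l \<in> ?P. ev l}"
      then have l: "l \<in> {..<m * d} \<rightarrow>\<^sub>E {..D}" "2 * S l \<le> D" "l \<noteq> zero_profile (m * d)" "ev l"
        by (auto simp: profiles_def S_def)
      have "S l = (\<Sum>b<d. block_sum d m l b)"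
        unfolding S_def block_sum_def by (rule sum.group[symmetric]) (auto intro: div_less_blocks)
      then have "even (S l)" using l(4) by (auto simp: ev_def intro!: dvd_sum)
      then obtain k where k: "S l = 2 * k" by blast
      have "k \<noteq> 0"
      proof
        assume "k = 0"
        then have "\<And>j. j < m * d \<Longrightarrow> l j = 0" using k by (auto simp: S_def)
        then have "l = zero_profile (m * d)" using l(1)
          by (auto simp: zero_profile_def PiE_def extensional_def fun_eq_iff)
        then show False using l(3) by simp
      qed
      then have mem: "l \<in> (\<Union>k\<in>{1..D}. even_profiles d m k)"
        using l k by (auto simp: even_profiles_def ev_def S_def intro!: bexI[of _ k])
      \<comment> \<open>The degree bound enters here: \<open>2 * S l \<le> D\<close> and
        \<open>S l = 2 * k\<close> give \<open>4 * k \<le> D\<close>.\<close>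
      have "fact (4 * k) \<le> real D ^ (4 * k)"
      proof -
        have "fact (4 * k) \<le> (4 * k) ^ (4 * k)"
          using fact_le_power[of "4 * k", where 'a = nat] by simp
        also have "\<dots> \<le> D ^ (4 * k)" using l(2) k by (intro power_mono) auto
        finally have "real (fact (4 * k)) \<le> real (D ^ (4 * k))" by (simp only: of_nat_le_iff)
        then show ?thesis by simp
      qed
      then have "6 * fact (2 * (2 * k)) / real d ^ (2 * k) * 2 ^ d \<le>
          6 * real D ^ (4 * k) / real d ^ (2 * k) * 2 ^ d"
        by (intro mult_right_mono divide_right_mono mult_left_mono) auto
      then have "M (2 * (2 * k)) \<le> (\<Sum>x\<in>spikes d. 6 * real D ^ (4 * k) / real d ^ (2 * k) * 2 ^ d)"
        unfolding M_def using sum_spikes_ip_power[OF d, of _ "2 * k"]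
        by (intro sum_mono) (meson order_trans)
      also have "\<dots> = 6 * real D ^ (4 * k) / real d ^ (2 * k) * 4 ^ d"
        by (simp only: sum_constant card_spikes[OF d]) (simp add: power_mult_distrib[symmetric])
      finally have "M (2 * S l) \<le> 6 * real D ^ (4 * k) / real d ^ (2 * k) * 4 ^ d" by (simp add: k)
      moreover have M0: "0 \<le> M (2 * S l)" unfolding M_def by (intro sum_nonneg) auto
      ultimately have "W l * (lam ^ (2 * S l) * M (2 * S l)) * 4 ^ d \<le> 1 * (lam ^ (2 * S l) *
          (6 * real D ^ (4 * k) / real d ^ (2 * k) * 4 ^ d)) * 4 ^ d"
        using W by (intro mult_right_mono mult_mono mult_left_mono) auto
      also have "\<dots> = 6 * (real D ^ 4 * lam ^ 4 / (real d)\<^sup>2) ^ k * (4 ^ d)\<^sup>2"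
        by (simp add: k power_mult[symmetric] power_mult_distrib power_divide power2_eq_square
            mult_ac)
          (simp add: power_add[symmetric] mult_2_right)
      finally show "\<exists>l'\<in>\<Union>k\<in>{1..D}. even_profiles d m k. l' = l \<and>
      W l * (lam ^ (2 * S l) * M (2 * S l)) * 4 ^ d \<le>
        6 * (real D ^ 4 * lam ^ 4 / (real d)\<^sup>2) ^ (S l' div 2) * (4 ^ d)\<^sup>2"
        using mem by (simp add: k)
    qed
  qed
  \<comment> \<open>The union is disjoint, since the total of a profile determines
    \<open>k\<close>.\<close>
  also have "\<dots> =
      (\<Sum>k\<in>{1..D}. \<Sum>l\<in>even_profiles d m k. 6 * (real D ^ 4 * lam ^ 4 / (real d)\<^sup>2) ^ (S l div 2) *
      (4 ^ d)\<^sup>2)"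
    using even_profiles_card by (intro sum.UNION_disjoint) (auto simp: even_profiles_def)
  also have "\<dots> =
      (\<Sum>k\<in>{1..D}. real (card (even_profiles d m k)) *
      (6 * (real D ^ 4 * lam ^ 4 / (real d)\<^sup>2) ^ k * (4 ^ d)\<^sup>2))"
    by (intro sum.cong refl) (simp add: even_profiles_def S_def)
  also have "\<dots> \<le>
      (\<Sum>k\<in>{1..D}. real ((d * m\<^sup>2) ^ k) * (6 * (real D ^ 4 * lam ^ 4 / (real d)\<^sup>2) ^ k * (4 ^ d)\<^sup>2))"
    using even_profiles_card by (intro sum_mono mult_right_mono) (auto simp del: of_nat_power)
  \<comment> \<open>One factor \<open>d\<close> from the choice of a block cancels one of the two in
    the denominator coming from the overlap moment.\<close>
  also have "\<dots> = (\<Sum>k\<in>{1..D}. ?q ^ k) * (6 * (4 ^ d)\<^sup>2)"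
    unfolding sum_distrib_right
  proof (intro sum.cong refl)
    fix k
    have regroup: "a * (6 * b * c) = a * b * (6 * c)" for a b c :: real by simp
    have "real (d * m\<^sup>2) * (real D ^ 4 * lam ^ 4 / (real d)\<^sup>2) = ?q"
      using d by (simp add: power2_eq_square)
    then have "real ((d * m\<^sup>2) ^ k) * (real D ^ 4 * lam ^ 4 / (real d)\<^sup>2) ^ k = ?q ^ k"
      by (simp only: of_nat_power power_mult_distrib[symmetric])
    then show "real ((d * m\<^sup>2) ^ k) * (6 * (real D ^ 4 * lam ^ 4 / (real d)\<^sup>2) ^ k * (4 ^ d)\<^sup>2) =
        ?q ^ k * (6 * (4 ^ d)\<^sup>2)"
      using regroup by (simp only:)
  qed
  also have "\<dots> \<le> 2 * ?q * (6 * (4 ^ d)\<^sup>2)"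
  proof (rule mult_right_mono)
    have q0: "0 \<le> ?q" by simp
    have "(\<Sum>k\<in>{1..D}. ?q ^ k) = (\<Sum>k<D. ?q ^ Suc k)"
      by (rule sum.reindex_bij_witness[of _ Suc "\<lambda>k. k - 1"]) auto
    also have "\<dots> \<le> (\<Sum>k<D. ?q * (1 / 2) ^ k)"
      unfolding power_Suc using q q0 by (intro sum_mono mult_left_mono power_mono) auto
    also have "\<dots> = ?q * (\<Sum>k<D. (1 / 2) ^ k)" by (simp add: sum_distrib_left)
    also have "\<dots> \<le> ?q * 2"
      using q0 by (intro mult_left_mono) (auto simp: sum_gp_strict)
    finally show "(\<Sum>k\<in>{1..D}. ?q ^ k) \<le> 2 * ?q" by (simp only: mult.commute)
  qed simp
  finally show ?thesis
    by (subst pos_divide_le_eq) simp_all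
qed

section \<open>The low-degree likelihood ratio\<close>

abbreviation euclid_borel :: "nat \<Rightarrow> (nat \<Rightarrow> real) measure" where
  "euclid_borel d \<equiv> \<Pi>\<^sub>M i\<in>{..<d}. borel"

lemma sets_std_gaussian [measurable_cong]: "sets (std_gaussian d) = sets (euclid_borel d)"
  unfolding std_gaussian_def by (intro sets_PiM_cong) auto

lemma measurable_linear_image [measurable]: "linear_image d A \<in> std_gaussian d \<rightarrow>\<^sub>M euclid_borel d"
proof -
  have [measurable]: "(\<lambda>z. z k) \<in> borel_measurable (std_gaussian d)" if "k < d" for k
    unfolding measurable_cong_sets[OF sets_std_gaussian refl] using that by simp
  show ?thesis
    unfolding linear_image_def[abs_def] by (rule measurable_restrict)
        (auto intro!: borel_measurable_sum)
qed

lemma measurable_mon [measurable]: "mon d e \<in> borel_measurable (euclid_borel d)"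
  unfolding mon_def[abs_def] by (auto intro!: borel_measurable_prod borel_measurable_power)

lemma gaussian_eq: "gaussian d S =
    distr (std_gaussian d) (euclid_borel d) (linear_image d (SOME A. cov_factor d S A))"
  by (simp add: gaussian_def Let_def linear_image_def[abs_def])

lemma prob_space_gaussian: "prob_space (gaussian d S)"
  unfolding gaussian_eq by
      (rule prob_space.prob_space_distr[OF prob_space_std_gaussian measurable_linear_image])

lemma sets_gaussian [measurable_cong]: "sets (gaussian d S) = sets (euclid_borel d)"
  by (simp add: gaussian_eq)

lemma integrable_gaussian_mon: "integrable (gaussian d S) (mon d e)"
  unfolding gaussian_eq
  by (subst integrable_distr_eq)
      (auto intro: poly_deriv_integrable[OF poly_deriv_linear_image[OF poly_deriv_mon]])

text \<open>The coefficient of \<open>He (2 * l)\<close> in the formal Hermite expansion of the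
  density of a centered Gaussian of variance \<open>1 + t\<close> relative to the standard one; the
  odd coefficients vanish by symmetry.\<close>

definition hermite_coef :: "real \<Rightarrow> nat \<Rightarrow> real" where
  "hermite_coef t l = (t / 2) ^ l / fact l"

lemma integral_gaussian_mon:
  assumes x: "(\<Sum>i<d. (x i)\<^sup>2) = 1" and t: "t \<ge> -1" and e: "(\<Sum>k<d. e k) \<le> 2 * L"
  shows "(\<integral>y. mon d e y \<partial>gaussian d (spiked_cov t x)) =
    (\<Sum>l\<le>L. hermite_coef t l * (\<integral>z. He (2 * l) (ip d x z) * mon d e z \<partial>std_gaussian d))"
proof -
  \<comment> \<open>For \<open>t \<ge> -1\<close> a factor exists, so the matrix chosen by
    \<open>SOME\<close> in \<open>gaussian\<close> is a genuine one.\<close>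
  have A: "cov_factor d (spiked_cov t x) (SOME A. cov_factor d (spiked_cov t x) A)"
    using someI_ex[OF spiked_cov_has_factor[OF t x]] .
  show ?thesis
    unfolding gaussian_eq hermite_coef_def
    by (subst integral_distr[OF measurable_linear_image measurable_mon])
        (rule integral_linear_image_mon[OF x A e])
qed

lemma product_sigma_finite_gaussian: "product_sigma_finite (\<lambda>j. gaussian d (S j))"
  by (simp add: product_sigma_finite_def prob_space_gaussian prob_space_imp_sigma_finite)

lemma product_sigma_finite_std_gaussian: "product_sigma_finite (\<lambda>_. std_gaussian d)"
  by (simp add: product_sigma_finite_def prob_space_std_gaussian prob_space_imp_sigma_finite)

text \<open>The integral factors over the vectors, each factor is expanded up to index
  \<open>D\<close>, and the product of sums is multiplied out. A term whose total Hermite degree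
  exceeds \<open>D\<close> vanishes by pigeonhole: for some vector the Hermite degree exceeds the
  degree of its monomial.\<close>

lemma integral_product_gaussian_mon:
  assumes x: "(\<Sum>i<d. (x i)\<^sup>2) = 1" and t: "\<And>j. j < n \<Longrightarrow> t j \<ge> -1"
    and e: "(\<Sum>j<n. \<Sum>i<d. e j i) \<le> D"
  shows "(\<integral>y. (\<Prod>j<n. mon d (e j) (y j)) \<partial>(\<Pi>\<^sub>M j\<in>{..<n}. gaussian d (spiked_cov (t j) x))) =
    (\<Sum>l\<in>profiles n D. \<Prod>j<n. hermite_coef (t j) (l j) *
      (\<integral>z. He (2 * l j) (ip d x z) * mon d (e j) z \<partial>std_gaussian d))"
    (is "_ = (\<Sum>l\<in>_. ?T l)")
proof -
  have "(\<integral>y. (\<Prod>j<n. mon d (e j) (y j)) \<partial>(\<Pi>\<^sub>M j\<in>{..<n}. gaussian d (spiked_cov (t j) x))) =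
      (\<Prod>j<n. \<integral>y. mon d (e j) y \<partial>gaussian d (spiked_cov (t j) x))"
    by (rule product_sigma_finite.product_integral_prod[OF product_sigma_finite_gaussian])
      (auto intro: integrable_gaussian_mon)
  also have "\<dots> = (\<Prod>j<n. \<Sum>l\<in>{..D}. hermite_coef (t j) l *
      (\<integral>z. He (2 * l) (ip d x z) * mon d (e j) z \<partial>std_gaussian d))"
  proof (rule prod.cong)
    fix j assume "j \<in> {..<n}"
    then have j: "j < n" by simp
    have "(\<Sum>i<d. e j i) \<le> (\<Sum>j<n. \<Sum>i<d. e j i)"
      using j by (intro member_le_sum) auto
    then have "(\<Sum>i<d. e j i) \<le> 2 * D" using e by simp
    then show "(\<integral>y. mon d (e j) y \<partial>gaussian d (spiked_cov (t j) x)) =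
        (\<Sum>l\<in>{..D}. hermite_coef (t j) l *
      (\<integral>z. He (2 * l) (ip d x z) * mon d (e j) z \<partial>std_gaussian d))"
      by (rule integral_gaussian_mon[OF x t[OF j]])
  qed simp
  also have "\<dots> = (\<Sum>l\<in>{..<n} \<rightarrow>\<^sub>E {..D}. ?T l)"
    by (rule prod_sum_PiE) auto
  also have "\<dots> = (\<Sum>l\<in>profiles n D. ?T l)"
  proof (rule sum.mono_neutral_right)
    show "\<forall>l\<in>({..<n} \<rightarrow>\<^sub>E {..D}) - profiles n D. ?T l = 0"
    proof
      fix l assume "l \<in> ({..<n} \<rightarrow>\<^sub>E {..D}) - profiles n D"
      then have "D < 2 * (\<Sum>j<n. l j)" by (simp add: profiles_def not_le)
      then have "(\<Sum>j<n. \<Sum>i<d. e j i) < (\<Sum>j<n. 2 * l j)" using e by (simp add: sum_distrib_left)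
      then obtain j where j: "j < n" "(\<Sum>i<d. e j i) < 2 * l j"
        by (metis (no_types, lifting) lessThan_iff not_le sum_mono)
      then have "hermite_coef (t j) (l j) * (\<integral>z. He (2 * l j) (ip d x z) *
          mon d (e j) z \<partial>std_gaussian d) = 0"
        by (simp add: integral_He_mon_eq_0[OF x])
      then show "?T l = 0" using j by (intro prod_zero) auto
    qed
  qed (auto simp: profiles_def intro: finite_PiE)
  finally show ?thesis .
qed

text \<open>\<open>tensor_poly d n\<close>: linear combinations of products \<open>\<Prod>j<n. G j (y j)\<close> with polynomials \<open>G j\<close>.\<close>

inductive tensor_poly :: "nat \<Rightarrow> nat \<Rightarrow> ((nat \<Rightarrow> nat \<Rightarrow> real) \<Rightarrow> real) \<Rightarrow> bool" for d n where
  zero: "tensor_poly d n (\<lambda>_. 0)"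
| add: "tensor_poly d n F \<Longrightarrow> (\<And>j. j < n \<Longrightarrow> \<exists>dG. poly_deriv d (G j) dG) \<Longrightarrow>
    tensor_poly d n (\<lambda>y. F y + c * (\<Prod>j<n. G j (y j)))"

lemma tensor_poly_add:
  assumes "tensor_poly d n F" "tensor_poly d n G" shows "tensor_poly d n (\<lambda>y. F y + G y)"
  using assms(2)
proof (induction rule: tensor_poly.induct)
  case zero
  then show ?case using assms(1) by simp
next
  case (add F' G' c)
  show ?case using tensor_poly.add[OF add.IH add.hyps(2), where c = c] by (simp add: add.assoc)
qed

lemma tensor_poly_prod: "(\<And>j. j < n \<Longrightarrow> \<exists>dG. poly_deriv d (G j) dG) \<Longrightarrow>
    tensor_poly d n (\<lambda>y. \<Prod>j<n. G j (y j))"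
  using tensor_poly.add[OF tensor_poly.zero, where c = 1] by simp

lemma tensor_poly_scale: "tensor_poly d n F \<Longrightarrow> tensor_poly d n (\<lambda>y. a * F y)"
proof (induction rule: tensor_poly.induct)
  case zero
  show ?case using tensor_poly.zero by simp
next
  case (add F G c)
  show ?case using tensor_poly.add[OF add.IH add.hyps(2), where c = "a * c"] by
      (simp add: algebra_simps)
qed

lemma tensor_poly_sum: "(\<And>k. k \<in> K \<Longrightarrow> tensor_poly d n (F k)) \<Longrightarrow> tensor_poly d n (\<lambda>y. \<Sum>k\<in>K. F k y)"
  by (induction K rule: infinite_finite_induct) (auto intro: tensor_poly.zero tensor_poly_add)

text \<open>This closure property yields the integrability of all the products in the Cauchy-Schwarz
  argument: two elementary products multiply vector by vector.\<close>

lemma tensor_poly_mult: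
  assumes F: "tensor_poly d n F" and "tensor_poly d n G" shows "tensor_poly d n (\<lambda>y. F y * G y)"
  using assms(2)
proof (induction rule: tensor_poly.induct)
  case zero
  then show ?case using tensor_poly.zero by simp
next
  case (add G H c)
  have "tensor_poly d n (\<lambda>y. F y * (\<Prod>j<n. H j (y j)))"
    using F
  proof (induction rule: tensor_poly.induct)
    case zero
    then show ?case using tensor_poly.zero by simp
  next
    case (add F' H' c)
    have "tensor_poly d n (\<lambda>y. \<Prod>j<n. H' j (y j) * H j (y j))"
      by (rule tensor_poly_prod)
          (use add.hyps(2) \<open>\<And>j. j < n \<Longrightarrow> \<exists>dG. poly_deriv d (H j) dG\<close> in \<open>blast intro: poly_deriv_mult\<close>)
    from tensor_poly_add[OF add.IH tensor_poly_scale[OF this, of c]] show ?case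
      by (simp add: prod.distrib algebra_simps)
  qed
  from tensor_poly_add[OF add.IH tensor_poly_scale[OF this, of c]] show ?case
    by (simp add: algebra_simps)
qed

section \<open>Hermite products under the null distribution\<close>

lemma null_product:
  fixes G :: "nat \<Rightarrow> (nat \<Rightarrow> real) \<Rightarrow> real"
  assumes "\<And>j. j < m * d \<Longrightarrow> integrable (std_gaussian d) (G j)"
  shows "integrable (null_dist d m) (\<lambda>y. \<Prod>j<m * d. G j (y j))"
    and "(\<integral>y. (\<Prod>j<m * d. G j (y j)) \<partial>null_dist d m) = (\<Prod>j<m * d. \<integral>z. G j z \<partial>std_gaussian d)"
proof -
  show "integrable (null_dist d m) (\<lambda>y. \<Prod>j<m * d. G j (y j))"
    unfolding null_dist_def
    by (rule product_sigma_finite.product_integrable_prod[OF product_sigma_finite_std_gaussian])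
      (use assms in auto)
  show "(\<integral>y. (\<Prod>j<m * d. G j (y j)) \<partial>null_dist d m) = (\<Prod>j<m * d. \<integral>z. G j z \<partial>std_gaussian d)"
    unfolding null_dist_def
    by (rule product_sigma_finite.product_integral_prod[OF product_sigma_finite_std_gaussian])
      (use assms in auto)
qed

lemma tensor_poly_integrable: "tensor_poly d (m * d) F \<Longrightarrow> integrable (null_dist d m) F"
proof (induction rule: tensor_poly.induct)
  case (add F G c)
  have "integrable (std_gaussian d) (G j)" if "j < m * d" for j
    using add.hyps(2)[OF that] poly_deriv_integrable by blast
  then show ?case using add.IH null_product(1)[of m d G] by simp
qed simp

lemma poly_fun_tensor_poly:
  assumes "poly_fun n d D f" shows "tensor_poly d n f"
proof -
  obtain E c where f: "\<And>y. f y = (\<Sum>e\<in>E. c e * (\<Prod>j<n. \<Prod>i<d. y j i ^ e j i))"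
    using assms unfolding poly_fun_def by blast
  have "tensor_poly d n (\<lambda>y. \<Sum>e\<in>E. c e * (\<Prod>j<n. mon d (e j) (y j)))"
    by (intro tensor_poly_sum tensor_poly_scale tensor_poly_prod) (use poly_deriv_mon in blast)
  moreover have "f = (\<lambda>y. \<Sum>e\<in>E. c e * (\<Prod>j<n. mon d (e j) (y j)))"
    using f by (simp add: mon_def fun_eq_iff)
  ultimately show ?thesis by simp
qed

text \<open>The term of profile \<open>l\<close> in the formal likelihood ratio conditional on the
  prior draw, where \<open>t j\<close> is the signed spike strength of the vector
  \<open>j\<close>.\<close>

definition hermite_prod :: "nat \<Rightarrow> nat \<Rightarrow> (nat \<Rightarrow> real) \<Rightarrow> (nat \<Rightarrow> real) \<Rightarrow> (nat \<Rightarrow> nat) \<Rightarrow>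
    (nat \<Rightarrow> nat \<Rightarrow> real) \<Rightarrow> real" where
  "hermite_prod d n x t l y = (\<Prod>j<n. hermite_coef (t j) (l j) * He (2 * l j) (ip d x (y j)))"

lemma tensor_poly_hermite_prod: "tensor_poly d n (hermite_prod d n x t l)"
proof -
  have "\<exists>dG. poly_deriv d (\<lambda>z. hermite_coef (t j) (l j) * He (2 * l j) (ip d x z)) dG" for j
    using poly_deriv_scale[OF poly_deriv_He] by blast
  then show ?thesis
    unfolding hermite_prod_def[abs_def] by (intro tensor_poly_prod)
qed

lemma hermite_prod_zero_profile: "hermite_prod d n x t (zero_profile n) y = 1"
  by (simp add: hermite_prod_def zero_profile_def hermite_coef_def)

text \<open>By linearity from monomials: for polynomials of degree at most \<open>D\<close>,
  integrating against the conditional planted law amounts to a null inner product with the truncated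
  formal likelihood ratio.\<close>

lemma poly_fun_integral_product_gaussian:
  assumes f: "poly_fun (m * d) d D f" and x: "(\<Sum>i<d. (x i)\<^sup>2) = 1"
    and t: "\<And>j. j < m * d \<Longrightarrow> t j \<ge> -1"
  defines "P \<equiv> \<Pi>\<^sub>M j\<in>{..<m * d}. gaussian d (spiked_cov (t j) x)"
  shows "integrable P f"
    and "(\<integral>y. f y \<partial>P) =
        (\<Sum>l\<in>profiles (m * d) D. \<integral>y. f y * hermite_prod d (m * d) x t l y \<partial>null_dist d m)"
proof -
  let ?n = "m * d"
  obtain E c where E: "finite E" "\<And>e. e \<in> E \<Longrightarrow> (\<Sum>j<?n. \<Sum>i<d. e j i) \<le> D"
    and "\<And>y. f y = (\<Sum>e\<in>E. c e * (\<Prod>j<?n. \<Prod>i<d. y j i ^ e j i))"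
    using f unfolding poly_fun_def by blast
  then have f: "f = (\<lambda>y. \<Sum>e\<in>E. c e * (\<Prod>j<?n. mon d (e j) (y j)))"
    by (auto simp: mon_def)
  have int: "integrable P (\<lambda>y. \<Prod>j<?n. mon d (e j) (y j))" for e
    unfolding P_def
    by (rule product_sigma_finite.product_integrable_prod[OF product_sigma_finite_gaussian])
      (auto intro: integrable_gaussian_mon)
  show "integrable P f" unfolding f using int by auto
  have deriv: "poly_deriv d (\<lambda>z. He (2 * l j) (ip d x z) * mon d (e j) z)
      (\<lambda>i z. (real (2 * l j) * x i * He (2 * l j - 1) (ip d x z)) * mon d (e j) z +
    He (2 * l j) (ip d x z) * (real (e j i) * mon d ((e j)(i := e j i - 1)) z))" for l e j
    by (rule poly_deriv_mult[OF poly_deriv_He poly_deriv_mon])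
  have int2: "integrable (std_gaussian d) (\<lambda>z. hermite_coef (t j) (l j) *
      (He (2 * l j) (ip d x z) * mon d (e j) z))" for l e j
    by (intro integrable_mult_right poly_deriv_integrable[OF deriv])
  have null: "integrable (null_dist d m) (\<lambda>y. (\<Prod>j<?n. mon d (e j) (y j)) *
      hermite_prod d ?n x t l y)"
    "(\<integral>y. (\<Prod>j<?n. mon d (e j) (y j)) * hermite_prod d ?n x t l y \<partial>null_dist d m) =
      (\<Prod>j<?n. hermite_coef (t j) (l j) * (\<integral>z. He (2 * l j) (ip d x z) *
          mon d (e j) z \<partial>std_gaussian d))" for e l
  proof -
    have eq: "(\<Prod>j<?n. mon d (e j) (y j)) * hermite_prod d ?n x t l y =
        (\<Prod>j<?n. hermite_coef (t j) (l j) * (He (2 * l j) (ip d x (y j)) * mon d (e j) (y j)))" for y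
      by (simp add: hermite_prod_def prod.distrib[symmetric] mult_ac)
    show "integrable (null_dist d m) (\<lambda>y. (\<Prod>j<?n. mon d (e j) (y j)) * hermite_prod d ?n x t l y)"
      unfolding eq by (rule null_product(1)[OF int2])
    show "(\<integral>y. (\<Prod>j<?n. mon d (e j) (y j)) * hermite_prod d ?n x t l y \<partial>null_dist d m) =
      (\<Prod>j<?n. hermite_coef (t j) (l j) * (\<integral>z. He (2 * l j) (ip d x z) *
          mon d (e j) z \<partial>std_gaussian d))"
      unfolding eq by (subst null_product(2)[OF int2]) simp_all
  qed
  have "(\<integral>y. f y \<partial>P) = (\<Sum>e\<in>E. c e * (\<integral>y. (\<Prod>j<?n. mon d (e j) (y j)) \<partial>P))"
    unfolding f using int by (subst Bochner_Integration.integral_sum) auto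
  also have "\<dots> = (\<Sum>e\<in>E. c e * (\<Sum>l\<in>profiles ?n D.
      \<integral>y. (\<Prod>j<?n. mon d (e j) (y j)) * hermite_prod d ?n x t l y \<partial>null_dist d m))"
    unfolding P_def null(2)
    by (intro sum.cong refl arg_cong2[of _ _ _ _ "(*)"] integral_product_gaussian_mon x t E)
  also have "\<dots> = (\<Sum>l\<in>profiles ?n D. \<Sum>e\<in>E. c e *
      (\<integral>y. (\<Prod>j<?n. mon d (e j) (y j)) * hermite_prod d ?n x t l y \<partial>null_dist d m))"
    unfolding sum_distrib_left by (rule sum.swap)
  also have "\<dots> = (\<Sum>l\<in>profiles ?n D. \<integral>y. f y * hermite_prod d ?n x t l y \<partial>null_dist d m)"
    unfolding f sum_distrib_right mult.assoc using null(1)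
    by (intro sum.cong refl, subst Bochner_Integration.integral_sum) auto
  finally show "(\<integral>y. f y \<partial>P) =
      (\<Sum>l\<in>profiles ?n D. \<integral>y. f y * hermite_prod d ?n x t l y \<partial>null_dist d m)" .
qed

text \<open>Vectors are independent under the null, so the integral is a product of Hermite inner
  products. Distinct profiles are orthogonal even for different spikes, because one factor has two
  different Hermite degrees.\<close>

lemma integral_hermite_prod_hermite_prod:
  assumes x: "(\<Sum>i<d. (x i)\<^sup>2) = 1" and x': "(\<Sum>i<d. (x' i)\<^sup>2) = 1"
    and l: "l \<in> profiles (m * d) D" "l' \<in> profiles (m * d) D"
  shows "(\<integral>y. hermite_prod d (m * d) x t l y * hermite_prod d (m * d) x' t' l' y \<partial>null_dist d m) =
    (if l = l' then \<Prod>j<m * d. hermite_weight (l j) * (t j * t' j * (ip d x x')\<^sup>2) ^ l j else 0)"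
proof -
  let ?n = "m * d"
  have deriv: "poly_deriv d (\<lambda>z. He (2 * l j) (ip d x z) * He (2 * l' j) (ip d x' z))
    (\<lambda>i z. (real (2 * l j) * x i * He (2 * l j - 1) (ip d x z)) * He (2 * l' j) (ip d x' z) +
    He (2 * l j) (ip d x z) * (real (2 * l' j) * x' i * He (2 * l' j - 1) (ip d x' z)))" for j
    by (rule poly_deriv_mult[OF poly_deriv_He poly_deriv_He])
  have int: "integrable (std_gaussian d) (\<lambda>z. hermite_coef (t j) (l j) *
      hermite_coef (t' j) (l' j) *
      (He (2 * l j) (ip d x z) * He (2 * l' j) (ip d x' z)))" for j
    by (intro integrable_mult_right poly_deriv_integrable[OF deriv])
  have "(\<integral>y. hermite_prod d ?n x t l y * hermite_prod d ?n x' t' l' y \<partial>null_dist d m) =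
    (\<integral>y. (\<Prod>j<?n. hermite_coef (t j) (l j) * hermite_coef (t' j) (l' j) *
      (He (2 * l j) (ip d x (y j)) * He (2 * l' j) (ip d x' (y j)))) \<partial>null_dist d m)"
    by (simp add: hermite_prod_def prod.distrib[symmetric] mult_ac)
  also have "\<dots> = (\<Prod>j<?n. hermite_coef (t j) (l j) * hermite_coef (t' j) (l' j) *
      (if 2 * l j = 2 * l' j then fact (2 * l j) * ip d x x' ^ (2 * l j) else 0))"
    by (subst null_product(2)[OF int])
        (simp_all only: integral_mult_right_zero integral_He_He[OF x x'])
  also have "\<dots> =
      (if l = l' then \<Prod>j<?n. hermite_weight (l j) * (t j * t' j * (ip d x x')\<^sup>2) ^ l j else 0)"
  proof (cases "l = l'")
    case True
    have "hermite_coef a k * hermite_coef b k * (fact (2 * k) * u ^ (2 * k)) =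
        hermite_weight k * (a * b * u\<^sup>2) ^ k" for a b u k
    proof -
      have "(4 :: real) ^ k = 2 ^ k * 2 ^ k" by (simp add: power_mult_distrib[symmetric])
      then show ?thesis
        by (simp add: hermite_coef_def hermite_weight_def power_mult_distrib power_divide
            power_mult power2_eq_square mult_ac)
    qed
    then show ?thesis using True by simp
  next
    case False
    \<comment> \<open>Profiles are extensional, so two different ones already differ at an index
      below \<open>m * d\<close>.\<close>
    have "\<exists>j<?n. l j \<noteq> l' j"
    proof (rule ccontr)
      assume "\<not> (\<exists>j<?n. l j \<noteq> l' j)"
      then have "l = l'"
        using l by (intro PiE_ext[of l "{..<?n}" "\<lambda>_. {..D}"]) (auto simp: profiles_def)
      then show False using False by simp
    qed
    then show ?thesis using False by (auto intro!: prod_zero)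
  qed
  finally show ?thesis .
qed

lemma measurable_planted_kernel:
  "(\<lambda>(x, s). \<Pi>\<^sub>M j\<in>{..<n}. gaussian d (S x s j)) \<in>
    measure_pmf p \<rightarrow>\<^sub>M subprob_algebra (\<Pi>\<^sub>M j\<in>{..<n}. euclid_borel d)"
proof -
  have "prob_space (\<Pi>\<^sub>M j\<in>{..<n}. gaussian d (S x s j))" for x s
    by (rule prob_space_PiM) (rule prob_space_gaussian)
  moreover have "sets (\<Pi>\<^sub>M j\<in>{..<n}. gaussian d (S x s j)) =
      sets (\<Pi>\<^sub>M j\<in>{..<n}. euclid_borel d)" for x s
    by (intro sets_PiM_cong refl sets_gaussian)
  \<comment> \<open>The prior is discrete, so measurability of the kernel reduces to its values
    being probability measures on the right sets.\<close>
  ultimately show ?thesis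
    by (auto simp: space_subprob_algebra prob_space_imp_subprob_space)
qed

text \<open>For a nonnegative integrand, the integral under the mixture is the prior average of the
  conditional integrals, a finite average over \<open>4 ^ d\<close> equally likely draws. The
  general case subtracts the negative part from the positive part, and integrability under the
  mixture comes with it.\<close>

lemma planted_has_bochner_integral:
  fixes f :: "(nat \<Rightarrow> nat \<Rightarrow> real) \<Rightarrow> real"
  assumes d: "d > 0" and f: "f \<in> borel_measurable (\<Pi>\<^sub>M j\<in>{..<m * d}. euclid_borel d)"
    and int: "\<And>x s. x \<in> spikes d \<Longrightarrow> s \<in> signs d \<Longrightarrow>
      integrable (\<Pi>\<^sub>M j\<in>{..<m * d}. gaussian d (spiked_cov (s (j div m) * lam) x)) f"
  shows "has_bochner_integral (planted_dist d m lam) f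
    ((\<Sum>x\<in>spikes d. \<Sum>s\<in>signs d.
      \<integral>y. f y \<partial>(\<Pi>\<^sub>M j\<in>{..<m * d}. gaussian d (spiked_cov (s (j div m) * lam) x))) / 4 ^ d)"
proof -
  define P where "P x s = (\<Pi>\<^sub>M j\<in>{..<m * d}. gaussian d (spiked_cov (s (j div m) * lam) x))" for x s
  let ?B = "\<Pi>\<^sub>M j\<in>{..<m * d}. euclid_borel d"
  let ?I = "\<lambda>h :: (nat \<Rightarrow> nat \<Rightarrow> real) \<Rightarrow> real. (\<Sum>x\<in>spikes d. \<Sum>s\<in>signs d. \<integral>y. h y \<partial>P x s) /
      (4 :: real) ^ d"
  have prior: "planted_prior d = pair_pmf (pmf_of_set (spikes d)) (pmf_of_set (signs d))"
    by (simp add: planted_prior_def)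
  have pl: "planted_dist d m lam = measure_pmf (planted_prior d) \<bind> (\<lambda>(x, s). P x s)"
    unfolding planted_dist_def P_def ..
  have ker: "(\<lambda>(x, s). P x s) \<in> measure_pmf (planted_prior d) \<rightarrow>\<^sub>M subprob_algebra ?B"
    unfolding P_def by (rule measurable_planted_kernel)
  have sets: "sets (planted_dist d m lam) = sets ?B"
    unfolding pl by (rule sets_bind[OF sets_kernel[OF ker]]) auto
  have fin: "finite (spikes d)" "finite (signs d)" by (intro finite_PiE; auto)+
  have ne: "spikes d \<noteq> {}" "signs d \<noteq> {}" by (auto simp: PiE_eq_empty_iff)
  have nonneg: "has_bochner_integral (planted_dist d m lam) h (?I h)"
    if h: "h \<in> borel_measurable ?B" and h0: "\<And>y. 0 \<le> h y"
      and hi: "\<And>x s. x \<in> spikes d \<Longrightarrow> s \<in> signs d \<Longrightarrow> integrable (P x s) h" for h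
  proof (rule has_bochner_integral_nn_integral)
    show "h \<in> borel_measurable (planted_dist d m lam)"
      using h unfolding measurable_cong_sets[OF sets refl] .
    show "0 \<le> ?I h" using h0 by (intro divide_nonneg_nonneg sum_nonneg integral_nonneg_AE) auto
    have "(\<integral>\<^sup>+ y. ennreal (h y) \<partial>planted_dist d m lam) =
        (\<integral>\<^sup>+ xs. (\<integral>\<^sup>+ y. ennreal (h y) \<partial>(\<lambda>(x, s). P x s) xs) \<partial>measure_pmf (planted_prior d))"
      unfolding pl using h by (intro nn_integral_bind[OF _ ker]) simp
    also have "\<dots> =
        (\<Sum>x\<in>spikes d. (\<Sum>s\<in>signs d. \<integral>\<^sup>+ y. ennreal (h y) \<partial>P x s) / card (signs d)) / card (spikes d)"
      unfolding prior
      by (simp add: nn_integral_pair_pmf' nn_integral_pmf_of_set fin ne)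
    also have "\<dots> =
        (\<Sum>x\<in>spikes d. (\<Sum>s\<in>signs d. ennreal (\<integral>y. h y \<partial>P x s)) / card (signs d)) / card (spikes d)"
      using h0 hi by (simp add: nn_integral_eq_integral cong: sum.cong)
    also have "\<dots> = ennreal ((\<Sum>x\<in>spikes d. (\<Sum>s\<in>signs d. \<integral>y. h y \<partial>P x s) / 2 ^ d) / 2 ^ d)"
      using h0 d by (simp add: card_spikes card_signs ennreal_of_nat_eq_real_of_nat divide_ennreal
          sum_nonneg integral_nonneg_AE sum_ennreal)
    also have "(\<Sum>x\<in>spikes d. (\<Sum>s\<in>signs d. \<integral>y. h y \<partial>P x s) / 2 ^ d) / 2 ^ d = ?I h"
      by (simp add: sum_divide_distrib[symmetric] power_mult_distrib[symmetric])
    finally show "(\<integral>\<^sup>+ y. ennreal (h y) \<partial>planted_dist d m lam) = ennreal (?I h)" .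
  qed (use h0 in auto)
  have int': "integrable (P x s) f" if "x \<in> spikes d" "s \<in> signs d" for x s
    unfolding P_def by (rule int[OF that])
  have "has_bochner_integral (planted_dist d m lam) (\<lambda>y. max 0 (f y) - max 0 (- f y))
     (?I (\<lambda>y. max 0 (f y)) - ?I (\<lambda>y. max 0 (- f y)))"
    using f int' by (intro has_bochner_integral_diff nonneg) auto
  moreover have "(\<lambda>y. max 0 (f y) - max 0 (- f y)) = f" by (auto simp: max_def)
  moreover have "?I (\<lambda>y. max 0 (f y)) - ?I (\<lambda>y. max 0 (- f y)) = ?I f"
  proof -
    have "(\<integral>y. max 0 (f y) \<partial>P x s) - (\<integral>y. max 0 (- f y) \<partial>P x s) = (\<integral>y. f y \<partial>P x s)"
      if "x \<in> spikes d" "s \<in> signs d" for x s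
    proof -
      have "(\<integral>y. max 0 (f y) \<partial>P x s) - (\<integral>y. max 0 (- f y) \<partial>P x s) =
          (\<integral>y. max 0 (f y) - max 0 (- f y) \<partial>P x s)"
        using int'[OF that] by (intro Bochner_Integration.integral_diff[symmetric]) auto
      then show ?thesis by (simp add: calculation(2)[THEN fun_cong])
    qed
    then show ?thesis
      by (simp add: diff_divide_distrib[symmetric] sum_subtractf[symmetric])
  qed
  ultimately show ?thesis unfolding P_def by simp
qed

text \<open>Nonnegativity of the squared distance from \<open>g\<close> to its projection
  \<open>u * f\<close>, where \<open>u\<close> is the inner product and \<open>f\<close> has norm
  1.\<close>

lemma cauchy_schwarz_unit:
  fixes f g :: "'a \<Rightarrow> real"
  assumes int: "integrable M (\<lambda>y. f y * f y)" "integrable M (\<lambda>y. f y * g y)"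
      "integrable M (\<lambda>y. g y * g y)"
    and f: "(\<integral>y. (f y)\<^sup>2 \<partial>M) = 1"
  shows "(\<integral>y. f y * g y \<partial>M)\<^sup>2 \<le> (\<integral>y. g y * g y \<partial>M)"
proof -
  define u where "u = (\<integral>y. f y * g y \<partial>M)"
  have "0 \<le> (\<integral>y. (g y - u * f y)\<^sup>2 \<partial>M)" by (intro integral_nonneg_AE) auto
  also have "\<dots> = (\<integral>y. g y * g y - 2 * u * (f y * g y) + u\<^sup>2 * (f y * f y) \<partial>M)"
    by (simp add: power2_eq_square algebra_simps)
  also have "\<dots> = (\<integral>y. g y * g y \<partial>M) - 2 * u * u + u\<^sup>2 * (\<integral>y. f y * f y \<partial>M)"
    unfolding u_def using int by simp
  also have "\<dots> = (\<integral>y. g y * g y \<partial>M) - u\<^sup>2"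
    using f by (simp add: power2_eq_square)
  finally show ?thesis by (simp add: u_def)
qed

text \<open>\<open>G\<close> is the truncated likelihood ratio averaged over the prior, without its
  constant term. The difference of expectations is the null inner product of \<open>f\<close> and
  \<open>G\<close>, so its square is at most the squared norm of \<open>G\<close>, which is expanded
  with a second prior draw \<open>(x', s')\<close>.\<close>

lemma advantage_bound:
  assumes d: "d > 0" and lam: "0 < lam" "lam < 1"
    and f: "poly_fun (m * d) d D f" and norm: "(\<integral>y. (f y)\<^sup>2 \<partial>null_dist d m) = 1"
    and q: "real D ^ 4 * (real m)\<^sup>2 * lam ^ 4 / real d \<le> 1 / 2"
  shows "((\<integral>y. f y \<partial>planted_dist d m lam) - (\<integral>y. f y \<partial>null_dist d m))\<^sup>2
    \<le> 12 * (real D ^ 4 * (real m)\<^sup>2 * lam ^ 4 / real d)"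
proof -
  let ?n = "m * d"
  let ?L = "profiles ?n D - {zero_profile ?n}"
  define t where "t s j = s (j div m) * lam" for s :: "nat \<Rightarrow> real" and j :: nat
  define Q where "Q x s l y = hermite_prod d ?n x (t s) l y" for x s l y
  define G where "G y = (\<Sum>x\<in>spikes d. \<Sum>s\<in>signs d. \<Sum>l\<in>?L. Q x s l y) / 4 ^ d" for y
  have fin: "finite (spikes d)" "finite (signs d)" "finite ?L"
    by (auto intro!: finite_PiE finite_profiles)
  have t: "t s j \<ge> -1" if "s \<in> signs d" "j < ?n" for s j
  proof -
    have "s (j div m) \<in> {1, -1}" using that div_less_blocks[OF that(2)] by (auto dest: PiE_mem)
    then show ?thesis using lam by (auto simp: t_def)
  qed
  have Qnp: "tensor_poly d ?n (Q x s l)" for x s l unfolding Q_def[abs_def] by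
      (rule tensor_poly_hermite_prod)
  have "tensor_poly d ?n (\<lambda>y. (1 / 4 ^ d) * (\<Sum>x\<in>spikes d. \<Sum>s\<in>signs d. \<Sum>l\<in>?L. Q x s l y))"
    by (intro tensor_poly_scale tensor_poly_sum Qnp)
  then have Gnp: "tensor_poly d ?n G" by (simp add: G_def[abs_def])
  have fnp: "tensor_poly d ?n f" by (rule poly_fun_tensor_poly[OF f])
  have fQ: "integrable (null_dist d m) (\<lambda>y. f y * Q x s l y)" for x s l
    by (intro tensor_poly_integrable tensor_poly_mult fnp Qnp)
  have QQ: "integrable (null_dist d m) (\<lambda>y. Q x s l y * Q x' s' l' y)" for x s l x' s' l'
    by (intro tensor_poly_integrable tensor_poly_mult Qnp)
  have meas: "f \<in> borel_measurable (\<Pi>\<^sub>M j\<in>{..<?n}. euclid_borel d)"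
  proof -
    have "sets (null_dist d m) = sets (\<Pi>\<^sub>M j\<in>{..<?n}. euclid_borel d)"
      unfolding null_dist_def by (intro sets_PiM_cong refl sets_std_gaussian)
    from measurable_cong_sets[OF this refl] tensor_poly_integrable[OF fnp] show ?thesis
      by (auto dest: borel_measurable_integrable)
  qed
  have zero: "zero_profile ?n \<in> profiles ?n D" by (auto simp: profiles_def zero_profile_def)
  have cond: "integrable (\<Pi>\<^sub>M j\<in>{..<?n}. gaussian d (spiked_cov (s (j div m) * lam) x)) f"
    "(\<integral>y. f y \<partial>(\<Pi>\<^sub>M j\<in>{..<?n}. gaussian d (spiked_cov (s (j div m) * lam) x))) =
      (\<integral>y. f y \<partial>null_dist d m) + (\<Sum>l\<in>?L. \<integral>y. f y * Q x s l y \<partial>null_dist d m)"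
    if x: "x \<in> spikes d" and s: "s \<in> signs d" for x s
  proof -
    note * = poly_fun_integral_product_gaussian[OF f spikes_unit[OF d x], of "t s", OF t[OF s]]
    show "integrable (\<Pi>\<^sub>M j\<in>{..<?n}. gaussian d (spiked_cov (s (j div m) * lam) x)) f"
      using *(1) by (simp add: t_def)
    have "(\<integral>y. f y \<partial>(\<Pi>\<^sub>M j\<in>{..<?n}. gaussian d (spiked_cov (s (j div m) * lam) x))) =
        (\<Sum>l\<in>profiles ?n D. \<integral>y. f y * Q x s l y \<partial>null_dist d m)"
      using *(2) by (simp add: t_def Q_def)
    \<comment> \<open>The zero profile contributes the constant 1 to the likelihood ratio, that is,
      the null expectation of \<open>f\<close>.\<close>
    also have "\<dots> = (\<integral>y. f y \<partial>null_dist d m) + (\<Sum>l\<in>?L. \<integral>y. f y * Q x s l y \<partial>null_dist d m)"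
      by (subst sum.remove[OF finite_profiles zero]) (simp add: Q_def hermite_prod_zero_profile)
    finally show "(\<integral>y. f y \<partial>(\<Pi>\<^sub>M j\<in>{..<?n}. gaussian d (spiked_cov (s (j div m) * lam) x))) =
      (\<integral>y. f y \<partial>null_dist d m) + (\<Sum>l\<in>?L. \<integral>y. f y * Q x s l y \<partial>null_dist d m)" .
  qed
  have "(\<integral>y. f y \<partial>planted_dist d m lam) = (\<Sum>x\<in>spikes d. \<Sum>s\<in>signs d.
      (\<integral>y. f y \<partial>null_dist d m) + (\<Sum>l\<in>?L. \<integral>y. f y * Q x s l y \<partial>null_dist d m)) / 4 ^ d"
    using has_bochner_integral_integral_eq[OF planted_has_bochner_integral[OF d meas cond(1)]]
    by (simp add: cond(2) cong: sum.cong)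
  also have "\<dots> =
      (\<integral>y. f y \<partial>null_dist d m) + (\<Sum>x\<in>spikes d. \<Sum>s\<in>signs d. \<Sum>l\<in>?L. \<integral>y.
      f y * Q x s l y \<partial>null_dist d m) / 4 ^ d"
  proof -
    have "(2::real) ^ d * 2 ^ d = 4 ^ d" by (simp add: power_mult_distrib[symmetric])
    then show ?thesis
      by (simp add: sum.distrib card_spikes[OF d] card_signs add_divide_distrib
          mult.assoc[symmetric])
  qed
  also have "(\<Sum>x\<in>spikes d. \<Sum>s\<in>signs d. \<Sum>l\<in>?L. \<integral>y. f y * Q x s l y \<partial>null_dist d m) / 4 ^ d =
      (\<integral>y. f y * G y \<partial>null_dist d m)"
    using fQ by (simp add: G_def sum_distrib_left)
  finally have diff: "(\<integral>y. f y \<partial>planted_dist d m lam) - (\<integral>y. f y \<partial>null_dist d m) =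
    (\<integral>y. f y * G y \<partial>null_dist d m)" by simp
  have "((\<integral>y. f y \<partial>planted_dist d m lam) - (\<integral>y. f y \<partial>null_dist d m))\<^sup>2 \<le>
      (\<integral>y. G y * G y \<partial>null_dist d m)"
    unfolding diff by
        (intro cauchy_schwarz_unit tensor_poly_integrable tensor_poly_mult fnp Gnp norm)
  also have "\<dots> = (\<integral>y. (\<Sum>x\<in>spikes d. \<Sum>s\<in>signs d. \<Sum>l\<in>?L. \<Sum>x'\<in>spikes d. \<Sum>s'\<in>signs d. \<Sum>l'\<in>?L.
      Q x s l y * Q x' s' l' y) \<partial>null_dist d m) / (4 ^ d)\<^sup>2"
    unfolding G_def times_divide_times_eq sum_distrib_right sum_distrib_left power2_eq_square
    by (simp add: mult.commute)
  also have "(\<integral>y. (\<Sum>x\<in>spikes d. \<Sum>s\<in>signs d. \<Sum>l\<in>?L. \<Sum>x'\<in>spikes d. \<Sum>s'\<in>signs d. \<Sum>l'\<in>?L.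
      Q x s l y * Q x' s' l' y) \<partial>null_dist d m) =
          (\<Sum>x\<in>spikes d. \<Sum>s\<in>signs d. \<Sum>l\<in>?L. \<Sum>x'\<in>spikes d. \<Sum>s'\<in>signs d. \<Sum>l'\<in>?L.
      \<integral>y. Q x s l y * Q x' s' l' y \<partial>null_dist d m)"
    using QQ by simp
  \<comment> \<open>Orthogonality collapses the double sum over profiles to its diagonal.\<close>
  also have "\<dots> = (\<Sum>x\<in>spikes d. \<Sum>s\<in>signs d. \<Sum>l\<in>?L. \<Sum>x'\<in>spikes d. \<Sum>s'\<in>signs d.
      \<Prod>j<?n. hermite_weight (l j) * (s (j div m) * s' (j div m) * lam\<^sup>2 * (ip d x x')\<^sup>2) ^ l j)"
  proof (intro sum.cong refl)
    fix x s l x' s'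
    assume a: "x \<in> spikes d" "x' \<in> spikes d" "l \<in> ?L"
    have "(\<Sum>l'\<in>?L. \<integral>y. Q x s l y * Q x' s' l' y \<partial>null_dist d m) =
      (\<Sum>l'\<in>?L. if l = l' then
           \<Prod>j<?n. hermite_weight (l j) * (t s j * t s' j * (ip d x x')\<^sup>2) ^ l j else 0)"
      unfolding Q_def using a
      by (intro sum.cong refl integral_hermite_prod_hermite_prod spikes_unit[OF d]) auto
    also have "\<dots> = (\<Prod>j<?n. hermite_weight (l j) * (t s j * t s' j * (ip d x x')\<^sup>2) ^ l j)"
      using a fin by (subst sum.delta') auto
    also have "\<dots> =
        (\<Prod>j<?n. hermite_weight (l j) * (s (j div m) * s' (j div m) * lam\<^sup>2 * (ip d x x')\<^sup>2) ^ l j)"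
      by (simp add: t_def power2_eq_square mult_ac)
    finally show "(\<Sum>l'\<in>?L. \<integral>y. Q x s l y * Q x' s' l' y \<partial>null_dist d m) =
      (\<Prod>j<?n. hermite_weight (l j) * (s (j div m) * s' (j div m) * lam\<^sup>2 * (ip d x x')\<^sup>2) ^ l j)" .
  qed
  also have "\<dots> = (\<Sum>x\<in>spikes d. \<Sum>s\<in>signs d. \<Sum>x'\<in>spikes d. \<Sum>s'\<in>signs d. \<Sum>l\<in>?L.
      \<Prod>j<?n. hermite_weight (l j) * (s (j div m) * s' (j div m) * lam\<^sup>2 * (ip d x x')\<^sup>2) ^ l j)"
    by (simp add: sum.swap[where A = ?L])
  also have "\<dots> / (4 ^ d)\<^sup>2 \<le> 12 * (real D ^ 4 * (real m)\<^sup>2 * lam ^ 4 / real d)"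
    by (rule second_moment_bound[OF d q])
  finally show ?thesis .
qed

section \<open>From the quantitative bound to the limit\<close>

lemma below_threshold:
  assumes d: "d > 0" and m: "m > 0" and lam: "0 < lam"
    and ln: "1 \<le> ln (real (d * m))" and c: "0 < c"
    and le: "lam \<le> c * (real d powr (1/4) / (sqrt (real m) * loss_factor 1 d m D))"
  shows "real D ^ 4 * (real m)\<^sup>2 * lam ^ 4 / real d \<le> c ^ 4"
proof -
  \<comment> \<open>With the logarithm at least 1, the loss factor dominates
    \<open>1 + real D\<close>. Hence \<open>lam * sqrt (real m) * real D\<close> is at most
    \<open>c * real d powr (1/4)\<close>, and the claim is the fourth power of this.\<close>
  have L: "real D \<le> loss_factor 1 d m D" "0 < loss_factor 1 d m D"
  proof -
    have "1 + real D \<le> loss_factor 1 d m D"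
      using ln by (simp add: loss_factor_def)
    then show "real D \<le> loss_factor 1 d m D" "0 < loss_factor 1 d m D"
      by auto
  qed
  have "lam * sqrt (real m) * real D \<le> lam * sqrt (real m) * loss_factor 1 d m D"
    using L lam by (intro mult_left_mono) auto
  also have "\<dots> \<le> c * real d powr (1/4)"
    using le L m by (simp add: field_simps)
  finally have "(lam * sqrt (real m) * real D) ^ 4 \<le> (c * real d powr (1/4)) ^ 4"
    using lam by (intro power_mono) auto
  moreover have "(lam * sqrt (real m) * real D) ^ 4 = real D ^ 4 * (real m)\<^sup>2 * lam ^ 4"
  proof -
    have "sqrt (real m) ^ 4 = (sqrt (real m) ^ 2) ^ 2" by (simp only: power_mult[symmetric]) simp
    then show ?thesis by (simp add: power_mult_distrib mult_ac)
  qed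
  moreover have "(c * real d powr (1/4)) ^ 4 = c ^ 4 * real d"
  proof -
    have "(real d powr (1/4)) ^ 4 = real d"
      using d by (simp add: powr_power)
    then show ?thesis by (simp add: power_mult_distrib)
  qed
  ultimately show ?thesis using d by (simp add: divide_le_eq)
qed

theorem theorem7p6:
  "\<exists>C. \<forall>(d :: nat \<Rightarrow> nat) (m :: nat \<Rightarrow> nat) (lam :: nat \<Rightarrow> real) (D :: nat \<Rightarrow> nat)
        (f :: nat \<Rightarrow> (nat \<Rightarrow> nat \<Rightarrow> real) \<Rightarrow> real).
     filterlim d at_top sequentially \<longrightarrow>
     filterlim m at_top sequentially \<longrightarrow>
     (\<forall>n. 0 < lam n \<and> lam n < 1) \<longrightarrow>
     lam \<in> o(\<lambda>n. real (d n) powr (1/4) / (sqrt (real (m n)) * loss_factor C (d n) (m n) (D n))) \<longrightarrow>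
     subpoly d m D \<longrightarrow>
     (\<forall>n. poly_fun (m n * d n) (d n) (D n) (f n)) \<longrightarrow>
     (\<forall>n. (\<integral>y. (f n y)\<^sup>2 \<partial>null_dist (d n) (m n)) = 1) \<longrightarrow>
     (\<lambda>n. \<bar>(\<integral>y. f n y \<partial>planted_dist (d n) (m n) (lam n))
          - (\<integral>y. f n y \<partial>null_dist (d n) (m n))\<bar>) \<longlonglongrightarrow> 0"
proof (intro exI[of _ 1] allI impI)
  fix d m :: "nat \<Rightarrow> nat" and lam :: "nat \<Rightarrow> real" and D :: "nat \<Rightarrow> nat"
    and f :: "nat \<Rightarrow> (nat \<Rightarrow> nat \<Rightarrow> real) \<Rightarrow> real"
  assume d: "filterlim d at_top sequentially" and m: "filterlim m at_top sequentially"
    and lam: "\<forall>n. 0 < lam n \<and> lam n < 1"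
    and small: "lam \<in> o(\<lambda>n. real (d n) powr (1/4) / (sqrt (real (m n)) *
        loss_factor 1 (d n) (m n) (D n)))"
    and f: "\<forall>n. poly_fun (m n * d n) (d n) (D n) (f n)"
    and norm: "\<forall>n. (\<integral>y. (f n y)\<^sup>2 \<partial>null_dist (d n) (m n)) = 1"
  let ?a = "\<lambda>n. (\<integral>y. f n y \<partial>planted_dist (d n) (m n) (lam n)) - (\<integral>y. f n y \<partial>null_dist (d n) (m n))"
  show "(\<lambda>n. \<bar>?a n\<bar>) \<longlonglongrightarrow> 0"
  proof (rule tendstoI)
    fix \<epsilon> :: real assume e: "\<epsilon> > 0"
    \<comment> \<open>The bound 1/2 gives \<open>c ^ 4 \<le> c\<^sup>2 / 4 \<le> 1 / 16\<close>, so
      the ratio is small enough for the geometric series. The bound by \<epsilon> / 4 gives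
      \<open>12 * c ^ 4 \<le> 3 * c\<^sup>2 \<le> 3 * \<epsilon>\<^sup>2 / 16\<close>, which is
      below the square of \<epsilon>.\<close>
    define c where "c = min (1 / 2) (\<epsilon> / 4)"
    have c: "0 < c" "c \<le> 1 / 2" "c \<le> \<epsilon> / 4" using e by (auto simp: c_def)
    have "c\<^sup>2 \<le> (1 / 2)\<^sup>2" "c\<^sup>2 \<le> (\<epsilon> / 4)\<^sup>2" using c by (auto intro!: power_mono)
    then have c2: "c\<^sup>2 \<le> 1 / 4" "c\<^sup>2 \<le> \<epsilon>\<^sup>2 / 16" by (simp_all add: power2_eq_square)
    have "c ^ 4 = c\<^sup>2 * c\<^sup>2" by (simp add: power2_eq_square power4_eq_xxxx)
    also have "\<dots> \<le> 1 / 4 * c\<^sup>2" using c2 by (intro mult_right_mono) auto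
    finally have c4: "c ^ 4 \<le> 1 / 4 * c\<^sup>2" .
    \<comment> \<open>These bounds make \<open>d n * m n\<close> at least 3, hence at least
      \<open>exp 1\<close>, so that its logarithm is at least 1.\<close>
    have "\<forall>\<^sub>F n in sequentially. d n \<ge> 1" "\<forall>\<^sub>F n in sequentially. m n \<ge> 3"
      using d m by (auto simp: filterlim_at_top)
    moreover have "\<forall>\<^sub>F n in sequentially. norm (lam n) \<le>
        c * norm (real (d n) powr (1/4) / (sqrt (real (m n)) * loss_factor 1 (d n) (m n) (D n)))"
      using landau_o.smallD[OF small c(1)] .
    ultimately show "\<forall>\<^sub>F n in sequentially. dist \<bar>?a n\<bar> 0 < \<epsilon>"
    proof eventually_elim
      case (elim n)
      have "exp 1 \<le> (3 :: real)" by (rule exp_le)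
      also have "\<dots> \<le> real (d n * m n)"
      proof -
        have "1 * 3 \<le> d n * m n" using elim by (intro mult_le_mono) auto
        then have "real (1 * 3) \<le> real (d n * m n)" by (simp only: of_nat_le_iff)
        then show ?thesis by simp
      qed
      finally have ln: "1 \<le> ln (real (d n * m n))"
        using elim by (subst ln_ge_iff) auto
      then have "0 \<le> loss_factor 1 (d n) (m n) (D n)" by (simp add: loss_factor_def)
      then have le: "lam n \<le>
          c * (real (d n) powr (1/4) / (sqrt (real (m n)) * loss_factor 1 (d n) (m n) (D n)))"
        using elim(3) lam by (simp add: abs_of_pos)
      have q: "real (D n) ^ 4 * (real (m n))\<^sup>2 * lam n ^ 4 / real (d n) \<le> c ^ 4"
        using elim lam ln c(1) le by (intro below_threshold) auto
      then have "real (D n) ^ 4 * (real (m n))\<^sup>2 * lam n ^ 4 / real (d n) \<le> 1 / 2"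
        using c4 c2 by linarith
      then have "(?a n)\<^sup>2 \<le> 12 * (real (D n) ^ 4 * (real (m n))\<^sup>2 * lam n ^ 4 / real (d n))"
        using elim lam f norm by (intro advantage_bound) auto
      also have "\<dots> < \<epsilon>\<^sup>2"
        using q c4 c2 zero_less_power[OF e, of 2] by linarith
      finally have "\<bar>?a n\<bar>\<^sup>2 < \<epsilon>\<^sup>2" by simp
      then have "\<bar>?a n\<bar> < \<epsilon>"
        by (rule power2_less_imp_less) (use e in auto)
      then show ?case by simp
    qed
  qed
qed

end
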